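(* For every integer $n\ge 2$, $n\le st_{\mathcal{D}}(n)\le 2n-2$.
   Context: For a finite set $P$ of points in the plane in general position, $st_{\mathcal{D}}(P)$ is the minimum of $|W|$ over finite point sets $W$ with $P\cup W$ in general position such that every open disk whose boundary circle passes through two distinct points of $P$ contains a point of $W$ (equivalently, such that the witness Delaunay graph $\mathrm{DG}^-(P,W)$ has no edges, where distinct $x,y\in P$ are adjacent in $\mathrm{DG}^-(P,W)$ iff some open disk containing no point of $W$ has $x,y$ on its bounding circle). Define $st_{\mathcal{D}}(n)=\max\{st_{\mathcal{D}}(P): P \text{ a set of } n \text{ points in general position}\}$. General position means no three distinct points are collinear and no four distinct points are concyclic. *)

theory Defs
  imports "HOL-Analysis.Analysis" "HOL-Library.Extended_Nat"
begin

type_synonym point = "real \<times> real"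

definition concyclic :: "point set \<Rightarrow> bool" where
  "concyclic S \<longleftrightarrow> (\<exists>c r. r > 0 \<and> (\<forall>p\<in>S. dist p c = r))"

definition general_position :: "point set \<Rightarrow> bool" where
  "general_position S \<longleftrightarrow>
     (\<forall>a\<in>S. \<forall>b\<in>S. \<forall>c\<in>S. a \<noteq> b \<and> a \<noteq> c \<and> b \<noteq> c \<longrightarrow> \<not> collinear {a, b, c}) \<and>
     (\<forall>a\<in>S. \<forall>b\<in>S. \<forall>c\<in>S. \<forall>d\<in>S.
        a \<noteq> b \<and> a \<noteq> c \<and> a \<noteq> d \<and> b \<noteq> c \<and> b \<noteq> d \<and> c \<noteq> d
        \<longrightarrow> \<not> concyclic {a, b, c, d})"

definition stabs_disks :: "point set \<Rightarrow> point set \<Rightarrow> bool" where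
  "stabs_disks P W \<longleftrightarrow>
     (\<forall>x\<in>P. \<forall>y\<in>P. \<forall>c r. x \<noteq> y \<and> r > 0 \<and> dist x c = r \<and> dist y c = r
        \<longrightarrow> (\<exists>w\<in>W. dist w c < r))"

text \<open>st_D(P), as an extended natural (infimum of the empty set would be infinity).\<close>
definition stD :: "point set \<Rightarrow> enat" where
  "stD P = (INF W\<in>{W. finite W \<and> general_position (P \<union> W) \<and> stabs_disks P W}.
              enat (card W))"

definition stD_n :: "nat \<Rightarrow> enat" where
  "stD_n n = (SUP P\<in>{P. finite P \<and> card P = n \<and> general_position P}. stD P)"

end

theory Submission
  imports Defs
begin

text \<open>
  Upper bound. Choose a linear functional that is injective on \<open>P\<close>. Every point except the highest one
  receives two witnesses very close to it, almost horizontally to its left and right but slightly above.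
  A disk through \<open>p\<close> and a higher point \<open>q\<close> contains one of the two witnesses of \<open>p\<close>, because \<open>q - p\<close> lies in
  the cone spanned by them. The witnesses range over open sets, so they can be chosen outside the finitely
  many lines and circles that would violate general position.

  Lower bound. Suppose that \<open>n\<close> points are joined by a chain of \<open>n - 1\<close> disks through consecutive points,
  consecutive disks being tangent to each other at the common point and all of them disjoint. Then at least
  \<open>n - 1\<close> witnesses are needed, and if there are exactly \<open>n - 1\<close>, every witness lies in exactly one of the
  disks. Moving the chain of disks in a continuous one-parameter family, a witness can never leave its disk,
  so it is confined to the intersection of the family. The points are placed on a convex chain such that all
  these intersections lie strictly on one side of the line through the two end points; then a large disk
  through the end points on the other side contains no witness. The chain starts with
  \<open>(-1, 1), (0, 0), (1, 1)\<close> and continues with nearly vertical steps, each tiny compared to the previous ones.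
\<close>

subsection \<open>General position\<close>

definition cross :: "point \<Rightarrow> point \<Rightarrow> real" where
  "cross u v = fst u * snd v - snd u * fst v"

lemma collinear_0_iff_cross:
  fixes u v :: point
  shows "collinear {0, u, v} \<longleftrightarrow> cross u v = 0"
proof
  assume "collinear {0, u, v}"
  then consider "u = 0" | "v = 0" | k where "v = k *\<^sub>R u"
    by (auto simp: collinear_lemma)
  then show "cross u v = 0"
    by cases (simp_all add: cross_def)
next
  assume *: "cross u v = 0"
  have "v = (snd v / snd u) *\<^sub>R u" if "snd u \<noteq> 0"
    using * that by (intro prod_eqI) (simp_all add: cross_def field_simps)
  moreover have "v = (fst v / fst u) *\<^sub>R u" if "fst u \<noteq> 0"
    using * that by (intro prod_eqI) (simp_all add: cross_def field_simps)
  ultimately show "collinear {0, u, v}"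
    unfolding collinear_lemma by (metis prod_eqI zero_prod_def fst_conv snd_conv)
qed

lemma collinear_iff_cross:
  fixes a b c :: point
  shows "collinear {a, b, c} \<longleftrightarrow> cross (b - a) (c - a) = 0"
  using collinear_3[of b a c] by (simp add: insert_commute collinear_0_iff_cross)

section \<open>Disks and circles seen from a boundary point\<close>

lemma dist_sq_point:
  fixes w c :: point
  shows "(dist w c)\<^sup>2 = (fst w - fst c)\<^sup>2 + (snd w - snd c)\<^sup>2"
  by (cases w; cases c) (simp add: dist_Pair_Pair dist_real_def)

text \<open>Expanding the squares cancels the square of \<open>c - p\<close>, so for a fixed
  \<open>w\<close> the condition is linear in the centre as seen from the boundary point
  \<open>p\<close>.\<close>

lemma mem_disk_iff:
  fixes w p c :: point
  shows "dist w c < dist p c \<longleftrightarrow> (w - p) \<bullet> (w - p) < 2 * ((w - p) \<bullet> (c - p))"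
proof -
  have "dist w c < dist p c \<longleftrightarrow> (dist w c)\<^sup>2 < (dist p c)\<^sup>2"
    by (metis abs_of_nonneg abs_square_less_1 power2_less_imp_less power_strict_mono pos2 zero_le_dist)
  also have "\<dots> \<longleftrightarrow> (w - p) \<bullet> (w - p) < 2 * ((w - p) \<bullet> (c - p))"
    unfolding dist_sq_point by (simp add: inner_prod_def power2_eq_square algebra_simps)
  finally show ?thesis .
qed

lemma on_circle_iff:
  fixes w p c :: point
  shows "dist w c = dist p c \<longleftrightarrow> (w - p) \<bullet> (w - p) = 2 * ((w - p) \<bullet> (c - p))"
proof -
  have "dist w c = dist p c \<longleftrightarrow> (dist w c)\<^sup>2 = (dist p c)\<^sup>2"
    by simp
  also have "\<dots> \<longleftrightarrow> (w - p) \<bullet> (w - p) = 2 * ((w - p) \<bullet> (c - p))"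
    unfolding dist_sq_point by (simp add: inner_prod_def power2_eq_square algebra_simps)
  finally show ?thesis .
qed

section \<open>Null sets of forbidden positions\<close>

lemma negligible_collinear:
  fixes a b :: point
  assumes "a \<noteq> b"
  shows "negligible {w. collinear {a, b, w}}"
proof -
  let ?n = "(- snd (b - a), fst (b - a))"
  have "{w. collinear {a, b, w}} = {w. ?n \<bullet> w = ?n \<bullet> a}"
    by (auto simp: collinear_iff_cross cross_def inner_prod_def algebra_simps)
  moreover have "?n \<noteq> 0"
    using assms by (auto simp: zero_prod_def prod_eq_iff)
  ultimately show ?thesis
    using negligible_hyperplane[of ?n "?n \<bullet> a"] by simp
qed

text \<open>The difference of two centres is orthogonal to \<open>b - a\<close> and
  \<open>c - a\<close>; these are independent, so Cramer's rule makes it zero.\<close>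

lemma circumcenter_unique:
  fixes a b c :: point
  assumes nc: "\<not> collinear {a, b, c}"
    and "dist b o1 = dist a o1" "dist c o1 = dist a o1"
    and "dist b o2 = dist a o2" "dist c o2 = dist a o2"
  shows "o1 = o2"
proof -
  define u where "u = o1 - o2"
  have eqs: "(b - a) \<bullet> u = 0" "(c - a) \<bullet> u = 0"
    using assms(2-) unfolding on_circle_iff u_def by (simp_all add: inner_prod_def algebra_simps)
  have "fst u * cross (b - a) (c - a) = 0" "snd u * cross (b - a) (c - a) = 0"
    using eqs unfolding cross_def inner_prod_def inner_real_def by algebra+
  then have "u = 0"
    using nc by (simp add: collinear_iff_cross prod_eq_iff)
  then show ?thesis by (simp add: u_def)
qed

text \<open>The circumcircle of \<open>a\<close>, \<open>b\<close>, \<open>c\<close>, if it exists,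
  is unique and a null set, and the fourth point must lie on it.\<close>

lemma negligible_concyclic:
  fixes a b c :: point
  assumes nc: "\<not> collinear {a, b, c}"
  shows "negligible {w. concyclic {a, b, c, w}}"
proof (cases "\<exists>o0 r. dist a o0 = r \<and> dist b o0 = r \<and> dist c o0 = r")
  case True
  then obtain o0 where o0: "dist b o0 = dist a o0" "dist c o0 = dist a o0"
    by auto
  have "{w. concyclic {a, b, c, w}} \<subseteq> sphere o0 (dist a o0)"
    using circumcenter_unique[OF nc _ _ o0] by (fastforce simp: concyclic_def dist_commute)
  then show ?thesis
    using negligible_sphere negligible_subset by blast
next
  case False
  then have "{w. concyclic {a, b, c, w}} = {}"
    by (auto simp: concyclic_def)
  then show ?thesis by (simp only: negligible_empty)
qed

text \<open>The bad positions form a finite union of points, lines and circles, hence a null set,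
  which cannot contain a nonempty open set.\<close>

lemma extend_general_position:
  assumes fin: "finite S" and gp: "general_position S" and U: "open U" "U \<noteq> {}"
  obtains w where "w \<in> U" "w \<notin> S" "general_position (insert w S)"
proof -
  define B where "B = S \<union> (\<Union>(a, b)\<in>{(a, b)\<in>S \<times> S. a \<noteq> b}. {w. collinear {a, b, w}})
     \<union> (\<Union>(a, b, c)\<in>{(a, b, c)\<in>S \<times> S \<times> S. \<not> collinear {a, b, c}}. {w. concyclic {a, b, c, w}})"
  have f2: "finite {(a, b)\<in>S \<times> S. a \<noteq> b}"
    by (rule finite_subset[of _ "S \<times> S"]) (use fin in auto)
  have f3: "finite {(a, b, c)\<in>S \<times> S \<times> S. \<not> collinear {a, b, c}}"
    by (rule finite_subset[of _ "S \<times> S \<times> S"]) (use fin in auto)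
  have "negligible B"
    unfolding B_def
    by (intro negligible_Un negligible_finite[OF fin] negligible_Union finite_imageI f2 f3)
      (auto intro: negligible_collinear negligible_concyclic)
  then have "\<not> U \<subseteq> B"
    using open_not_negligible[OF U] negligible_subset by blast
  then obtain w where w: "w \<in> U" "w \<notin> B" by blast
  have wS: "w \<notin> S" using w by (auto simp: B_def)
  have col: "\<not> collinear {a, b, w}" if "a \<in> S" "b \<in> S" "a \<noteq> b" for a b
    using w(2) that unfolding B_def by blast
  have conc: "\<not> concyclic {a, b, c, w}"
    if "a \<in> S" "b \<in> S" "c \<in> S" "a \<noteq> b" "a \<noteq> c" "b \<noteq> c" for a b c
  proof -
    have "\<not> collinear {a, b, c}"
      using gp that unfolding general_position_def by blast
    then show ?thesis using w(2) that unfolding B_def by blast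
  qed
  have "general_position (insert w S)"
    unfolding general_position_def
  proof (intro conjI ballI impI; elim conjE)
    fix a b c assume "a \<in> insert w S" "b \<in> insert w S" "c \<in> insert w S" "a \<noteq> b" "a \<noteq> c" "b \<noteq> c"
    moreover have "{a, b, c} = {a, c, b}" "{a, b, c} = {b, c, a}" by auto
    ultimately show "\<not> collinear {a, b, c}"
      using col gp unfolding general_position_def by (metis insertE)
  next
    fix a b c d assume *: "a \<in> insert w S" "b \<in> insert w S" "c \<in> insert w S" "d \<in> insert w S"
      "a \<noteq> b" "a \<noteq> c" "a \<noteq> d" "b \<noteq> c" "b \<noteq> d" "c \<noteq> d"
    \<comment> \<open>Concyclicity depends only on the set, so \<open>w\<close> can always be moved
      to the last place.\<close>
    have perm: "{a, b, c, d} = {a, b, d, c}" "{a, b, c, d} = {a, c, d, b}" "{a, b, c, d} = {b, c, d, a}"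
      by auto
    consider "a = w" | "b = w" | "c = w" | "d = w" | "w \<notin> {a, b, c, d}" by blast
    then show "\<not> concyclic {a, b, c, d}"
    proof cases
      case 1 with * conc perm(3) show ?thesis by (metis insertE)
    next
      case 2 with * conc perm(2) show ?thesis by (metis insertE)
    next
      case 3 with * conc perm(1) show ?thesis by (metis insertE)
    next
      case 4 with * conc show ?thesis by (metis insertE)
    next
      case 5
      with * have "a \<in> S" "b \<in> S" "c \<in> S" "d \<in> S" by auto
      with * gp show ?thesis unfolding general_position_def by blast
    qed
  qed
  with w wS that show ?thesis by blast
qed

text \<open>One point is picked per open set, each avoiding the bad positions created by all earlier
  ones.\<close>

lemma general_position_hitting_set:
  assumes "finite \<U>" "finite S" "general_position S" "\<And>U. U \<in> \<U> \<Longrightarrow> open U \<and> U \<noteq> {}"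
  shows "\<exists>W. finite W \<and> card W \<le> card \<U> \<and> general_position (S \<union> W) \<and> (\<forall>U\<in>\<U>. U \<inter> W \<noteq> {})"
  using assms(1,4)
proof (induction \<U> rule: finite_induct)
  case empty
  show ?case by (rule exI[of _ "{}"]) (use assms in simp)
next
  case (insert U \<U>)
  then obtain W where W: "finite W" "card W \<le> card \<U>" "general_position (S \<union> W)" "\<forall>U\<in>\<U>. U \<inter> W \<noteq> {}"
    by auto
  have U: "open U" "U \<noteq> {}" using insert.prems by auto
  obtain w where w: "w \<in> U" "general_position (insert w (S \<union> W))"
    using extend_general_position[OF _ W(3) U] W(1) assms(2) by (metis finite_Un)
  have "card (insert w W) \<le> card (insert U \<U>)"
    using W(1,2) insert.hyps by (simp add: card_insert_if)
  with W w show ?case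
    by (intro exI[of _ "insert w W"]) auto
qed

subsection \<open>Upper bound\<close>

text \<open>In orthogonal coordinates centred at a point of \<open>P\<close>, the circle through it with centre
  \<open>(X, Y)\<close> also passes through \<open>(x, y)\<close>; the witnesses are \<open>(a1, b1)\<close> and \<open>(- a2, b2)\<close>.\<close>

lemma two_witness_inequality:
  fixes x y X Y :: real
  assumes q: "2 * (x * X + y * Y) = x\<^sup>2 + y\<^sup>2" and y: "0 < y"
    and d: "0 < \<delta>" "\<delta> \<le> 1" "\<delta> * \<bar>x\<bar> \<le> y" and e: "0 < \<epsilon>" "35 * \<epsilon> < \<delta> * y"
    and 1: "\<epsilon> < a1" "a1 < 2 * \<epsilon>" "\<delta> * \<epsilon> / 2 < b1" "b1 < \<delta> * \<epsilon>"
    and 2: "\<epsilon> < a2" "a2 < 2 * \<epsilon>" "\<delta> * \<epsilon> / 2 < b2" "b2 < \<delta> * \<epsilon>"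
    and w1: "2 * (a1 * X + b1 * Y) \<le> a1\<^sup>2 + b1\<^sup>2"
    and w2: "2 * (- a2 * X + b2 * Y) \<le> a2\<^sup>2 + b2\<^sup>2"
  shows False
proof -
  \<comment> \<open>The right-hand sides of \<open>w1\<close> and \<open>w2\<close> are of second
    order in \<open>\<epsilon>\<close>.\<close>
  have bnd: "a\<^sup>2 + b\<^sup>2 \<le> 5 * \<epsilon>\<^sup>2" if "\<epsilon> < a" "a < 2 * \<epsilon>" "\<delta> * \<epsilon> / 2 < b" "b < \<delta> * \<epsilon>" for a b :: real
  proof -
    have "0 < \<delta> * \<epsilon>" using d e by simp
    then have "b > 0" using that by linarith
    have "\<delta> * \<epsilon> \<le> \<epsilon>" using d e by (simp add: mult_left_le_one_le)
    then have "b\<^sup>2 \<le> \<epsilon>\<^sup>2" using that(4) \<open>b > 0\<close> \<open>\<delta> * \<epsilon> \<le> \<epsilon>\<close> by (intro power_mono) auto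
    moreover have "a\<^sup>2 \<le> (2 * \<epsilon>)\<^sup>2" using that e by (intro power_mono) auto
    ultimately show ?thesis by (simp add: power2_eq_square)
  qed
  \<comment> \<open>The witnesses lie on opposite sides, each at horizontal distance more than
    \<open>\<epsilon>\<close>, so together they bound \<open>X\<close> from both sides.\<close>
  have scale: "\<bar>X\<bar> \<le> K" if "a1 * X \<le> \<epsilon> * K" "- (a2 * X) \<le> \<epsilon> * K" "0 \<le> K" for K
  proof -
    have "\<epsilon> * \<bar>X\<bar> \<le> \<epsilon> * K"
    proof (cases "0 \<le> X")
      case True
      then have "\<epsilon> * X \<le> a1 * X" using 1 by (intro mult_right_mono) auto
      with that True show ?thesis by simp
    next
      case False
      then have "\<epsilon> * (- X) \<le> a2 * (- X)" using 2 by (intro mult_right_mono) auto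
      then show ?thesis using that False unfolding abs_of_neg[of X, OF False[unfolded not_le]] by linarith
    qed
    then show ?thesis using e by simp
  qed
  have xX: "x * X \<le> \<bar>x\<bar> * \<bar>X\<bar>" by (metis abs_ge_self abs_mult)
  have b0: "0 < b1" "0 < b2" using 1 2 d e by (smt (verit) mult_pos_pos half_gt_zero)+
  have y2: "\<delta> * y\<^sup>2 \<le> \<delta> * (x\<^sup>2 + y\<^sup>2)" using d by simp
  have ey: "35 * \<epsilon> * y < \<delta> * y\<^sup>2" using e y by (simp add: power2_eq_square)
  have edx: "\<epsilon> * (\<delta> * \<bar>x\<bar>) \<le> \<epsilon> * y" using d e by simp
  note B1 = bnd[OF 1] and B2 = bnd[OF 2]
  show False
  proof (cases "0 \<le> Y")
    case True
    \<comment> \<open>Centre not below: \<open>X\<close> is at most \<open>5/2 * \<epsilon>\<close>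
      in size and \<open>\<delta> * Y\<close> at most \<open>15 * \<epsilon>\<close>. Inserted into
      \<open>q\<close> these give
      \<open>\<delta> * y\<^sup>2 \<le> (5 + 30) * \<epsilon> * y\<close>, whence the constant
      35.\<close>
    have "0 \<le> b1 * Y" "0 \<le> b2 * Y" using True b0 by simp_all
    then have X: "\<bar>X\<bar> \<le> 5 / 2 * \<epsilon>"
      using w1 w2 B1 B2 e by (intro scale) (simp_all add: power2_eq_square algebra_simps)
    have "- (a1 * X) \<le> (2 * \<epsilon>) * (5 / 2 * \<epsilon>)"
    proof -
      have "a1 * (- X) \<le> a1 * \<bar>X\<bar>" using 1 e by (intro mult_left_mono) auto
      also have "\<dots> \<le> (2 * \<epsilon>) * (5 / 2 * \<epsilon>)" using X 1 e by (intro mult_mono) auto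
      finally show ?thesis by simp
    qed
    then have "2 * (b1 * Y) \<le> 15 * \<epsilon>\<^sup>2"
      using w1 B1 by (simp add: power2_eq_square)
    moreover have "\<delta> * \<epsilon> / 2 * Y \<le> b1 * Y" using 1 True by (intro mult_right_mono) auto
    ultimately have "\<epsilon> * (\<delta> * Y) \<le> \<epsilon> * (15 * \<epsilon>)" by (simp add: power2_eq_square algebra_simps)
    then have "\<delta> * Y \<le> 15 * \<epsilon>" using e by simp
    then have "(\<delta> * Y) * y \<le> 15 * \<epsilon> * y" using y by (intro mult_right_mono) auto
    moreover have "\<delta> * (\<bar>x\<bar> * \<bar>X\<bar>) \<le> \<delta> * (\<bar>x\<bar> * (5 / 2 * \<epsilon>))"
      using X d by (intro mult_left_mono) auto
    moreover have "\<delta> * (x\<^sup>2 + y\<^sup>2) \<le> 2 * (\<delta> * (\<bar>x\<bar> * \<bar>X\<bar>)) + 2 * ((\<delta> * Y) * y)"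
      using mult_left_mono[OF xX, of \<delta>] d unfolding q[symmetric] by (simp add: algebra_simps)
    moreover have "\<delta> * (\<bar>x\<bar> * (5 / 2 * \<epsilon>)) = 5 / 2 * (\<epsilon> * (\<delta> * \<bar>x\<bar>))" by simp
    ultimately show False using y2 ey edx by linarith
  next
    case False
    \<comment> \<open>Centre below: the part \<open>\<delta> * Z\<close> of the bound on
      \<open>X\<close> is cancelled in \<open>q\<close> by \<open>y * Z\<close>, since
      \<open>\<delta> * \<bar>x\<bar> \<le> y\<close>.\<close>
    define Z where "Z = - Y"
    have Z: "0 < Z" "Y = - Z" using False by (simp_all add: Z_def)
    have "b1 * Z \<le> \<delta> * \<epsilon> * Z" "b2 * Z \<le> \<delta> * \<epsilon> * Z"
      using Z(1) 1 2 by simp_all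
    moreover have "2 * (a1 * X) - 2 * (b1 * Z) \<le> 5 * \<epsilon>\<^sup>2" "- 2 * (a2 * X) - 2 * (b2 * Z) \<le> 5 * \<epsilon>\<^sup>2"
      using w1 w2 B1 B2 by (simp_all add: Z(2))
    ultimately have "a1 * X \<le> 5 / 2 * \<epsilon>\<^sup>2 + \<delta> * \<epsilon> * Z" "- (a2 * X) \<le> 5 / 2 * \<epsilon>\<^sup>2 + \<delta> * \<epsilon> * Z"
      by simp_all
    moreover have "5 / 2 * \<epsilon>\<^sup>2 + \<delta> * \<epsilon> * Z = \<epsilon> * (5 / 2 * \<epsilon> + \<delta> * Z)"
      by (simp add: power2_eq_square algebra_simps)
    moreover have "0 \<le> 5 / 2 * \<epsilon> + \<delta> * Z" using Z(1) d e by simp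
    ultimately have "\<bar>X\<bar> \<le> 5 / 2 * \<epsilon> + \<delta> * Z" by (intro scale) simp_all
    then have "\<bar>x\<bar> * \<bar>X\<bar> \<le> \<bar>x\<bar> * (5 / 2 * \<epsilon> + \<delta> * Z)" by (intro mult_left_mono) auto
    moreover have "(\<delta> * \<bar>x\<bar>) * Z \<le> y * Z" using d Z(1) by (intro mult_right_mono) auto
    ultimately have "x\<^sup>2 + y\<^sup>2 \<le> 5 * \<epsilon> * \<bar>x\<bar>"
      using xX unfolding q[symmetric] Z(2) by (simp add: algebra_simps)
    then have "\<delta> * (x\<^sup>2 + y\<^sup>2) \<le> \<delta> * (5 * \<epsilon> * \<bar>x\<bar>)" using d by simp
    then have "\<delta> * y\<^sup>2 \<le> 5 * (\<epsilon> * (\<delta> * \<bar>x\<bar>))" using y2 by (simp add: mult_ac)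
    moreover have "0 < \<epsilon> * y" using e y by simp
    ultimately show False using ey edx by linarith
  qed
qed

text \<open>\<open>d * f q\<close> tends to 0 as \<open>d\<close> decreases to 0, and finitely many
  eventual conditions hold simultaneously.\<close>

lemma finite_small_multiple:
  fixes f g :: "'a \<Rightarrow> real"
  assumes "finite Q" "\<And>q. q \<in> Q \<Longrightarrow> 0 < g q"
  shows "\<exists>d>0. d \<le> 1 \<and> (\<forall>q\<in>Q. d * f q < g q)"
proof -
  have "eventually (\<lambda>d. d * f q < g q) (at_right 0)" if "q \<in> Q" for q
  proof (rule order_tendstoD(2))
    show "((\<lambda>d. d * f q) \<longlongrightarrow> 0 * f q) (at_right 0)"
      by (intro tendsto_intros)
  qed (use assms that in simp)
  then have "eventually (\<lambda>d. \<forall>q\<in>Q. d * f q < g q) (at_right 0)"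
    using assms(1) by (simp add: eventually_ball_finite)
  moreover have "eventually (\<lambda>d::real. 0 < d \<and> d < 1) (at_right 0)"
    unfolding eventually_at_right_field by (intro exI[of _ 1]) auto
  ultimately have "eventually (\<lambda>d. (\<forall>q\<in>Q. d * f q < g q) \<and> 0 < d \<and> d < 1) (at_right 0)"
    by (rule eventually_conj)
  then obtain d where "(\<forall>q\<in>Q. d * f q < g q) \<and> 0 < d \<and> d < 1"
    using eventually_happens[of _ "at_right (0::real)"] by force
  then show ?thesis by (intro exI[of _ d]) auto
qed

lemma two_witness_regions:
  fixes p :: point and \<eta> :: real
  assumes "finite Q" "\<And>q. q \<in> Q \<Longrightarrow> 0 < \<eta> * fst (q - p) + snd (q - p)"
  shows "\<exists>U V. open U \<and> U \<noteq> {} \<and> open V \<and> V \<noteq> {} \<and>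
    (\<forall>u\<in>U. \<forall>v\<in>V. \<forall>q\<in>Q. \<forall>c. dist q c = dist p c \<longrightarrow> dist u c < dist p c \<or> dist v c < dist p c)"
proof -
  \<comment> \<open>Coordinates along the orthogonal vectors \<open>(1, - \<eta>)\<close> and
    \<open>(\<eta>, 1)\<close>, left unnormalised; \<open>G\<close> is their common squared
    length.\<close>
  define ex gx :: "point \<Rightarrow> real"
    where "ex z = fst z - \<eta> * snd z" and "gx z = \<eta> * fst z + snd z" for z
  define G where "G = 1 + \<eta>\<^sup>2"
  have G: "G > 0" by (simp add: G_def add_pos_nonneg)
  have in_G: "G * (z \<bullet> m) = ex z * ex m + gx z * gx m" for z m
    by (simp add: ex_def gx_def G_def inner_prod_def power2_eq_square algebra_simps)
  obtain \<delta> where \<delta>: "0 < \<delta>" "\<delta> \<le> 1" "\<And>q. q \<in> Q \<Longrightarrow> \<delta> * \<bar>ex (q - p)\<bar> < gx (q - p)"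
    using finite_small_multiple[OF assms(1), where f = "\<lambda>q. \<bar>ex (q - p)\<bar>" and g = "\<lambda>q. gx (q - p)"] assms(2)
    unfolding gx_def by blast
  obtain \<epsilon> where \<epsilon>: "0 < \<epsilon>" "\<And>q. q \<in> Q \<Longrightarrow> \<epsilon> * 35 < \<delta> * gx (q - p)"
    using finite_small_multiple[OF assms(1), where f = "\<lambda>_. 35" and g = "\<lambda>q. \<delta> * gx (q - p)"] assms(2) \<delta>(1)
    unfolding gx_def by (meson mult_pos_pos)
  \<comment> \<open>An open box near \<open>p\<close>; the sign \<open>\<sigma>\<close> selects the
    side. The point \<open>p + z\<close> below is its centre.\<close>
  define R :: "real \<Rightarrow> point set" where
    "R \<sigma> = {w. \<epsilon> < \<sigma> * ex (w - p) \<and> \<sigma> * ex (w - p) < 2 * \<epsilon> \<and>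
             \<delta> * \<epsilon> / 2 < gx (w - p) \<and> gx (w - p) < \<delta> * \<epsilon>}" for \<sigma>
  have op: "open (R \<sigma>)" for \<sigma>
    unfolding R_def ex_def gx_def
    by (intro open_Collect_conj open_Collect_less continuous_intros)
  have ne: "R \<sigma> \<noteq> {}" if "\<sigma> * \<sigma> = 1" for \<sigma>
  proof -
    define a b where "a = \<sigma> * (3 / 2 * \<epsilon>)" and "b = 3 / 4 * (\<delta> * \<epsilon>)"
    define z where "z = ((a + \<eta> * b) / G, (b - \<eta> * a) / G)"
    have "ex z = a" "gx z = b"
      using G by (simp_all add: z_def ex_def gx_def divide_simps) (simp_all add: G_def power2_eq_square algebra_simps)
    moreover have "\<sigma> * a = 3 / 2 * \<epsilon>" using that by (simp add: a_def)
    moreover have "0 < \<delta> * \<epsilon>" using \<delta> \<epsilon> by simp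
    ultimately have "p + z \<in> R \<sigma>"
      unfolding R_def using \<epsilon>(1) by (simp add: b_def)
    then show ?thesis by blast
  qed
  have stab: "dist u c < dist p c \<or> dist v c < dist p c"
    if u: "u \<in> R 1" and v: "v \<in> R (-1)" and q: "q \<in> Q" "dist q c = dist p c" for u v q c
  proof (rule ccontr)
    assume "\<not> ?thesis"
    then have "2 * ((u - p) \<bullet> (c - p)) \<le> (u - p) \<bullet> (u - p)" "2 * ((v - p) \<bullet> (c - p)) \<le> (v - p) \<bullet> (v - p)"
      unfolding mem_disk_iff by auto
    then have "G * (2 * ((u - p) \<bullet> (c - p))) \<le> G * ((u - p) \<bullet> (u - p))"
      "G * (2 * ((v - p) \<bullet> (c - p))) \<le> G * ((v - p) \<bullet> (v - p))"
      using G by simp_all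
    then have w: "2 * (ex (u - p) * ex (c - p) + gx (u - p) * gx (c - p)) \<le> (ex (u - p))\<^sup>2 + (gx (u - p))\<^sup>2"
      "2 * (- (- ex (v - p)) * ex (c - p) + gx (v - p) * gx (c - p)) \<le> (- ex (v - p))\<^sup>2 + (gx (v - p))\<^sup>2"
      unfolding mult.left_commute[of G 2] in_G by (simp_all add: power2_eq_square)
    have "G * (2 * ((q - p) \<bullet> (c - p))) = G * ((q - p) \<bullet> (q - p))"
      using q(2) unfolding on_circle_iff by simp
    then have "2 * (ex (q - p) * ex (c - p) + gx (q - p) * gx (c - p)) = (ex (q - p))\<^sup>2 + (gx (q - p))\<^sup>2"
      unfolding mult.left_commute[of G 2] in_G by (simp add: power2_eq_square)
    then show False
      using u v q(1) \<delta> \<epsilon> assms(2)[OF q(1)]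
      by (intro two_witness_inequality[OF _ _ _ _ _ _ _ _ _ _ _ _ _ _ _ w, of "ex (q - p)" "gx (q - p)" \<delta> \<epsilon>])
        (auto simp: R_def gx_def less_imp_le mult.commute)
  qed
  show ?thesis
    using op[of 1] ne[of 1] op[of "-1"] ne[of "-1"] stab
    by (intro exI[of _ "R 1"] exI[of _ "R (-1)"]) (simp del: split_paired_All split_paired_Ex)
qed

lemma finite_points_generic_functional:
  fixes P :: "point set"
  assumes "finite P"
  obtains \<eta> where "inj_on (\<lambda>z. \<eta> * fst z + snd z) P"
proof -
  \<comment> \<open>The values of \<open>\<eta>\<close> at which two points tie. Equal first
    coordinates give a division by zero, which merely adds 0 to the set; such points are separated
    by their second coordinates.\<close>
  let ?bad = "(\<lambda>(p, q). - (snd p - snd q) / (fst p - fst q)) ` (P \<times> P)"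
  obtain \<eta> where \<eta>: "\<eta> \<notin> ?bad"
    using ex_new_if_finite[OF infinite_UNIV_char_0, of ?bad] assms by auto
  have "p = q" if "p \<in> P" "q \<in> P" "\<eta> * fst p + snd p = \<eta> * fst q + snd q" for p q
  proof -
    have "fst p = fst q"
    proof (rule ccontr)
      assume "fst p \<noteq> fst q"
      then have "\<eta> = - (snd p - snd q) / (fst p - fst q)"
        using that(3) by (simp add: field_simps)
      with that(1,2) \<eta> show False by force
    qed
    with that(3) show ?thesis by (simp add: prod_eq_iff)
  qed
  then show ?thesis by (intro that[of \<eta>] inj_onI)
qed

lemma stD_upper:
  assumes fin: "finite P" and ne: "P \<noteq> {}" and gp: "general_position P"
  shows "stD P \<le> enat (2 * card P - 2)"
proof -
  obtain \<eta> where \<eta>: "inj_on (\<lambda>z. \<eta> * fst z + snd z) P"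
    using finite_points_generic_functional[OF fin] .
  define h :: "point \<Rightarrow> real" where "h z = \<eta> * fst z + snd z" for z
  have inj: "inj_on h P" using \<eta> by (simp add: h_def[abs_def])
  have "Max (h ` P) \<in> h ` P" using fin ne by simp
  then obtain top where "top \<in> P" "h top = Max (h ` P)" by auto
  then have top: "top \<in> P" "\<And>q. q \<in> P \<Longrightarrow> h q \<le> h top"
    using fin by auto
  define good where "good p U V \<longleftrightarrow> open U \<and> U \<noteq> {} \<and> open V \<and> V \<noteq> {} \<and>
    (\<forall>u\<in>U. \<forall>v\<in>V. \<forall>q\<in>{q \<in> P. h p < h q}. \<forall>c. dist q c = dist p c \<longrightarrow> dist u c < dist p c \<or> dist v c < dist p c)"
    for p :: point and U V
  have "\<exists>U V. good p U V" for p
    unfolding good_def using fin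
    by (intro two_witness_regions[of _ \<eta>]) (auto simp: h_def algebra_simps)
  then obtain U V where UV: "\<And>p. good p (U p) (V p)" by metis
  let ?\<U> = "U ` (P - {top}) \<union> V ` (P - {top})"
  have "finite ?\<U>" using fin by simp
  moreover have "open X \<and> X \<noteq> {}" if "X \<in> ?\<U>" for X
    using that UV unfolding good_def by auto
  ultimately obtain W where W: "finite W" "card W \<le> card ?\<U>" "general_position (P \<union> W)" "\<forall>X\<in>?\<U>. X \<inter> W \<noteq> {}"
    using general_position_hitting_set[OF _ fin gp, of ?\<U>] by metis
  have "card ?\<U> \<le> card (P - {top}) + card (P - {top})"
    by (rule order_trans[OF card_Un_le add_mono]) (use fin in \<open>auto intro: card_image_le\<close>)
  also have "\<dots> = 2 * card P - 2" using top(1) fin by simp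
  finally have card: "card W \<le> 2 * card P - 2" using W(2) by simp
  have stab: "\<exists>w\<in>W. dist w c < dist p c" if "p \<in> P" "q \<in> P" "h p < h q" "dist q c = dist p c" for p q c
  proof -
    \<comment> \<open>A higher point \<open>q\<close> exists, so \<open>p\<close> is not the top and
      did receive two witnesses.\<close>
    have "p \<in> P - {top}" using that top(2)[of q] by auto
    then have "U p \<inter> W \<noteq> {}" "V p \<inter> W \<noteq> {}" using W(4) by simp_all
    then obtain u v where "u \<in> U p" "u \<in> W" "v \<in> V p" "v \<in> W" by fast
    moreover have "\<forall>u\<in>U p. \<forall>v\<in>V p. \<forall>q\<in>{q \<in> P. h p < h q}. \<forall>c. dist q c = dist p c \<longrightarrow>
        dist u c < dist p c \<or> dist v c < dist p c"
      using UV[of p] unfolding good_def by (elim conjE)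
    then have "dist u c < dist p c \<or> dist v c < dist p c" if "u \<in> U p" "v \<in> V p" for u v
      using that \<open>q \<in> P\<close> \<open>h p < h q\<close> \<open>dist q c = dist p c\<close> by (simp del: split_paired_All)
    ultimately show ?thesis by blast
  qed
  have "stabs_disks P W"
    unfolding stabs_disks_def
  proof (intro ballI allI impI, elim conjE)
    fix x y c r assume xy: "x \<in> P" "y \<in> P" "x \<noteq> y" "dist x c = r" "dist y c = r"
    then have "h x < h y \<or> h y < h x"
      using inj by (metis inj_onD linorder_neqE)
    then show "\<exists>w\<in>W. dist w c < r"
      using stab[of x y c] stab[of y x c] xy by auto
  qed
  then have "stD P \<le> enat (card W)"
    unfolding stD_def using W(1,3) by (intro INF_lower) simp
  also have "\<dots> \<le> enat (2 * card P - 2)" using card by simp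
  finally show ?thesis .
qed

subsection \<open>Lower bound\<close>

text \<open>Disks through \<open>x\<close> and \<open>y\<close> with ever more distant centres on
  the left of the line fill the open left half-plane. If all witnesses except \<open>x\<close> and
  \<open>y\<close>, which lie on the boundary, were strictly to the right, a large enough disk would
  miss them all.\<close>

lemma stabs_disks_side:
  assumes st: "stabs_disks P W" and fin: "finite W" and xy: "x \<in> P" "y \<in> P" "x \<noteq> y"
  shows "\<exists>w\<in>W. w \<noteq> x \<and> w \<noteq> y \<and> 0 \<le> cross (y - x) (w - x)"
proof (rule ccontr)
  assume "\<not> ?thesis"
  then have neg: "cross (y - x) (w - x) < 0" if "w \<in> W - {x, y}" for w
    using that by force
  define e where "e = y - x"
  define f where "f w = (w - x) \<bullet> e - (w - x) \<bullet> (w - x)" for w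
  have pos: "0 < - 2 * cross e (w - x)" if "w \<in> W - {x, y}" for w
    using neg[OF that] by (simp add: e_def)
  obtain d where d: "0 < d" "\<forall>w\<in>W - {x, y}. d * f w < - 2 * cross e (w - x)"
    using finite_small_multiple[where f = f and g = "\<lambda>w. - 2 * cross e (w - x)", OF finite_Diff[OF fin, of "{x, y}"]] pos
    by metis
  \<comment> \<open>The centre relative to \<open>x\<close>: the midpoint of the segment, moved by
    \<open>1 / d\<close> times the left normal of \<open>e\<close>. A small \<open>d\<close> means a
    distant centre.\<close>
  define m where "m = (1 / 2) *\<^sub>R e + (1 / d) *\<^sub>R (- snd e, fst e)"
  have m: "v \<bullet> m = (v \<bullet> e) / 2 + cross e v / d" for v
  proof -
    have "v \<bullet> (- snd e, fst e) = cross e v" by (simp add: inner_prod_def cross_def)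
    then show ?thesis unfolding m_def inner_add_right inner_scaleR_right by simp
  qed
  have "cross e e = 0" by (simp add: cross_def)
  then have circ: "dist y (x + m) = dist x (x + m)"
    unfolding on_circle_iff using m[of e] by (simp add: e_def)
  have "0 < dist x (x + m)"
    using xy(3) circ by (metis dist_nz zero_less_dist_iff)
  then obtain w where w: "w \<in> W" "dist w (x + m) < dist x (x + m)"
    using st xy circ unfolding stabs_disks_def by metis
  then have "(w - x) \<bullet> (w - x) < (w - x) \<bullet> e + 2 * cross e (w - x) / d"
    unfolding mem_disk_iff by (simp add: m)
  then have "- 2 * cross e (w - x) / d < f w" by (simp add: f_def)
  with d(1) have "- 2 * cross e (w - x) < d * f w" by (metis pos_divide_less_eq mult.commute)
  moreover have "w \<in> W - {x, y}" using w circ by auto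
  ultimately show False using bspec[OF d(2), of w] by simp
qed

section \<open>Counting witnesses along a chain of disks\<close>

text \<open>In the initial chain the centres, seen from the end points, have direction
  \<open>(t, -1)\<close>. The bound 1/3 is below the limit 1/2 of \<open>tangent_disk_step\<close>
  but above the slope 1/4 used for the cones.\<close>

abbreviation params :: "real set" where
  "params \<equiv> {-1/3..1/3}"

text \<open>For every parameter \<open>t\<close>, the disk number \<open>i < m\<close> has centre \<open>c i t\<close> and passes through
  \<open>p i\<close> and \<open>p (Suc i)\<close>; the open disks are pairwise disjoint. A point that lies in disk \<open>i\<close> for all
  \<open>t\<close> is confined to a downward cone at some \<open>p k\<close>, and these cones lie strictly below the line through
  \<open>p 0\<close> and \<open>p m\<close>, whose slope \<open>s\<close> is smaller than that of the cones.\<close>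

definition disk_chain :: "nat \<Rightarrow> (nat \<Rightarrow> point) \<Rightarrow> (nat \<Rightarrow> real \<Rightarrow> point) \<Rightarrow> bool" where
  "disk_chain m p c \<longleftrightarrow>
     inj_on p {..m} \<and> general_position (p ` {..m}) \<and>
     (\<forall>i<m. continuous_on params (c i)) \<and>
     (\<forall>i<m. \<forall>t\<in>params. dist (p i) (c i t) = dist (p (Suc i)) (c i t)) \<and>
     (\<forall>i<m. \<forall>j<i. \<forall>t\<in>params.
        dist (p (Suc i)) (c i t) + dist (p (Suc j)) (c j t) \<le> dist (c i t) (c j t)) \<and>
     (\<forall>i<m. \<exists>k\<le>m. \<forall>w. (\<forall>t\<in>params. dist w (c i t) < dist (p (Suc i)) (c i t)) \<longrightarrow>
        snd w - snd (p k) < - \<bar>fst w - fst (p k)\<bar> / 4) \<and>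
     p 0 = (-1, 1) \<and> - 1 < fst (p m) \<and>
     (\<exists>s. 0 \<le> s \<and> s < 1/4 \<and> snd (p m) = 1 + s * (fst (p m) + 1) \<and>
        (\<forall>k\<le>m. - 1 \<le> fst (p k) \<and> snd (p k) \<le> 1 + s * (fst (p k) + 1)))"

lemma disk_chain_stabbing_number:
  assumes ch: "disk_chain m p c" and fin: "finite W" and st: "stabs_disks (p ` {..m}) W"
  shows "m < card W"
proof (rule ccontr)
  assume "\<not> m < card W"
  then have le: "card W \<le> m" by simp
  define D where "D i t = {w. dist w (c i t) < dist (p (Suc i)) (c i t)}" for i t
  have inj: "inj_on p {..m}" and cont: "\<And>i. i < m \<Longrightarrow> continuous_on params (c i)"
    and circ: "\<And>i t. i < m \<Longrightarrow> t \<in> params \<Longrightarrow> dist (p i) (c i t) = dist (p (Suc i)) (c i t)"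
    and tang: "\<And>i j t. i < m \<Longrightarrow> j < i \<Longrightarrow> t \<in> params \<Longrightarrow>
        dist (p (Suc i)) (c i t) + dist (p (Suc j)) (c j t) \<le> dist (c i t) (c j t)"
    and cone: "\<And>i. i < m \<Longrightarrow> \<exists>k\<le>m. \<forall>w. (\<forall>t\<in>params. dist w (c i t) < dist (p (Suc i)) (c i t)) \<longrightarrow>
        snd w - snd (p k) < - \<bar>fst w - fst (p k)\<bar> / 4"
    and p0: "p 0 = (-1, 1)" "- 1 < fst (p m)"
    using ch unfolding disk_chain_def by meson+
  obtain s where s: "0 \<le> s" "s < 1/4" "snd (p m) = 1 + s * (fst (p m) + 1)"
    "\<And>k. k \<le> m \<Longrightarrow> snd (p k) \<le> 1 + s * (fst (p k) + 1)"
    using ch unfolding disk_chain_def by meson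
  \<comment> \<open>Centres at least the sum of the radii apart make the open disks
    disjoint.\<close>
  have disj: "i = j" if "i < m" "j < m" "t \<in> params" "w \<in> D i t" "w \<in> D j t" for i j t w
  proof (rule ccontr)
    assume "i \<noteq> j"
    then have "dist (p (Suc i)) (c i t) + dist (p (Suc j)) (c j t) \<le> dist (c i t) (c j t)"
      using tang[of i j t] tang[of j i t] that by (cases "j < i") (auto simp: dist_commute)
    moreover have "dist (c i t) (c j t) \<le> dist w (c i t) + dist w (c j t)" by (rule dist_triangle3)
    ultimately show False using that(4,5) by (simp add: D_def)
  qed
  have hit: "\<exists>w\<in>W. w \<in> D i t" if "i < m" "t \<in> params" for i t
  proof -
    have ne: "p i \<noteq> p (Suc i)" using inj_onD[OF inj, of i "Suc i"] that(1) by auto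
    then have "0 < dist (p (Suc i)) (c i t)"
      using circ[OF that] by (metis dist_eq_0_iff zero_less_dist_iff)
    moreover have "p i \<in> p ` {..m}" "p (Suc i) \<in> p ` {..m}" using that(1) by auto
    ultimately show ?thesis
      using st[unfolded stabs_disks_def, rule_format, of "p i" "p (Suc i)" "dist (p (Suc i)) (c i t)" "c i t"]
        circ[OF that] ne unfolding D_def by auto
  qed
  \<comment> \<open>Choosing a witness in each of the \<open>m\<close> disjoint disks is injective,
    so with at most \<open>m\<close> witnesses the choice exhausts \<open>W\<close>.\<close>
  have cover: "\<exists>i<m. w \<in> D i t" if w: "w \<in> W" and t: "t \<in> params" for w t
  proof -
    have "\<forall>i. \<exists>v. i < m \<longrightarrow> v \<in> W \<and> v \<in> D i t" using hit[OF _ t] by blast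
    then obtain f where f: "\<And>i. i < m \<Longrightarrow> f i \<in> W \<and> f i \<in> D i t"
      unfolding choice_iff by blast
    have "inj_on f {..<m}"
    proof (rule inj_onI)
      fix i j assume "i \<in> {..<m}" "j \<in> {..<m}" "f i = f j"
      then show "i = j" using disj[OF _ _ t, of i j "f i"] f[of i] f[of j] by simp
    qed
    then have "card (f ` {..<m}) = m" by (simp add: card_image)
    moreover have sub: "f ` {..<m} \<subseteq> W" using f by auto
    ultimately have "f ` {..<m} = W" using fin le by (metis card_mono card_subset_eq le_antisym)
    then show ?thesis using w f by auto
  qed
  have stay: "\<exists>i<m. \<forall>t\<in>params. w \<in> D i t" if w: "w \<in> W" for w
  proof -
    \<comment> \<open>The index is unique by \<open>disj\<close>. Membership in an open disk
      persists for nearby \<open>t\<close>, so the index is locally constant, hence constant on the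
      connected interval.\<close>
    define idx where "idx t = (SOME i. i < m \<and> w \<in> D i t)" for t
    have idx: "idx t < m" "w \<in> D (idx t) t" if "t \<in> params" for t
      using someI_ex[of "\<lambda>i. i < m \<and> w \<in> D i t"] cover[OF w that] unfolding idx_def by blast+
    have "\<forall>t\<in>params. eventually (\<lambda>t'. idx t = idx t') (at t within params)"
    proof
      fix t :: real assume t: "t \<in> params"
      define i where "i = idx t"
      have i: "i < m" "w \<in> D i t" using idx[OF t] by (simp_all add: i_def)
      have "((\<lambda>t'. dist (p (Suc i)) (c i t') - dist w (c i t')) \<longlongrightarrow> dist (p (Suc i)) (c i t) - dist w (c i t))
          (at t within params)"
        using cont[OF i(1)] t unfolding continuous_on_def by (intro tendsto_intros) auto
      then have "eventually (\<lambda>t'. 0 < dist (p (Suc i)) (c i t') - dist w (c i t')) (at t within params)"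
        by (rule order_tendstoD) (use i in \<open>simp add: D_def\<close>)
      moreover have "eventually (\<lambda>t'. t' \<in> params) (at t within params)"
        by (simp add: eventually_at_topological) blast
      ultimately show "eventually (\<lambda>t'. idx t = idx t') (at t within params)"
      proof eventually_elim
        case (elim t')
        then show ?case
          using disj[OF i(1) idx(1)[of t'] _ _ idx(2)] by (simp add: i_def D_def)
      qed
    qed
    moreover have "connected params" by simp
    moreover have "0 \<in> params" by simp
    ultimately have "idx t = idx 0" if "t \<in> params" for t
      using connected_local_const[of params 0 t idx] that by metis
    then show ?thesis using idx \<open>0 \<in> params\<close> by metis
  qed
  have below: "cross (p m - p 0) (w - p 0) < 0" if "w \<in> W" for w
  proof -
    obtain i where i: "i < m" "\<forall>t\<in>params. w \<in> D i t" using stay[OF \<open>w \<in> W\<close>] by blast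
    obtain k where k: "k \<le> m" "snd w - snd (p k) < - \<bar>fst w - fst (p k)\<bar> / 4"
      using cone[OF i(1)] i(2) unfolding D_def by blast
    \<comment> \<open>The cone at \<open>p k\<close> falls off with slope 1/4 on both sides, faster
      than the line of slope \<open>s\<close> through the end points, and \<open>p k\<close> is not
      above that line.\<close>
    have "s * (fst (p k) - fst w) \<le> s * \<bar>fst w - fst (p k)\<bar>"
      using s(1) by (intro mult_left_mono) auto
    also have "\<dots> \<le> 1/4 * \<bar>fst w - fst (p k)\<bar>"
      using s(2) by (intro mult_right_mono) auto
    finally have "snd w < 1 + s * (fst w + 1)"
      using k(2) s(4)[OF k(1)] by (simp add: algebra_simps)
    then have "(fst (p m) + 1) * (snd w - 1 - s * (fst w + 1)) < 0"
      using p0(2) by (intro mult_pos_neg) auto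
    then show ?thesis
      using s(3) by (simp add: cross_def p0(1) algebra_simps)
  qed
  have "p m \<noteq> p 0" using p0 by auto
  then obtain w where "w \<in> W" "0 \<le> cross (p m - p 0) (w - p 0)"
    using stabs_disks_side[OF st fin, of "p 0" "p m"] by force
  with below[of w] show False by simp
qed

text \<open>Each side of the line through \<open>x\<close> and \<open>y\<close> needs a witness, and
  a shared one would lie on the line, against general position.\<close>

lemma pair_stabbing_number:
  assumes "x \<noteq> y" "finite W" "general_position ({x, y} \<union> W)" "stabs_disks {x, y} W"
  shows "2 \<le> card W"
proof -
  obtain u where u: "u \<in> W" "u \<noteq> x" "u \<noteq> y" "0 \<le> cross (y - x) (u - x)"
    using stabs_disks_side[OF assms(4,2), of x y] assms(1) by blast
  obtain v where v: "v \<in> W" "0 \<le> cross (x - y) (v - y)"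
    using stabs_disks_side[OF assms(4,2), of y x] assms(1) by blast
  have "u \<noteq> v"
  proof
    assume "u = v"
    then have "cross (y - x) (u - x) = 0" using u(4) v(2) by (simp add: cross_def algebra_simps)
    then have "collinear {x, y, u}" by (simp add: collinear_iff_cross)
    then show False
      using assms(3)[unfolded general_position_def, THEN conjunct1, rule_format, of x y u] assms(1) u(1-3) by auto
  qed
  then have "card {u, v} = 2" by simp
  then show ?thesis using u v assms(2)
    card_mono[of W "{u, v}"] by simp
qed

section \<open>Adding one point to a chain\<close>

text \<open>\<open>N\<close> is the centre of a disk with the origin on its boundary, and \<open>C\<close> is the centre of the disk
  through the origin and \<open>e\<close> that touches the first one from outside at the origin. The slope bounds on
  \<open>C - e\<close> reproduce those on \<open>N\<close> up to a change of sign of the first coordinate, which is what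
  allows the construction to be iterated.\<close>

lemma tangent_disk_step:
  fixes N e C :: point
  assumes N: "snd N < 0" "\<bar>fst N\<bar> \<le> M * (- snd N)" "M < 1/2"
    and e: "0 < snd e" "\<bar>fst e\<bar> \<le> \<zeta> * snd e" and z: "0 < \<zeta>" "6 * \<zeta> \<le> 1/2 - M"
    and C: "C = (e \<bullet> e / (2 * (N \<bullet> e))) *\<^sub>R N"
  shows "N \<bullet> e < 0"
    and "dist e C = dist 0 C" and "norm C \<le> 4 * snd e" and "dist N C = norm N + norm C"
    and "norm N + snd e / 3 \<le> dist e N"
    and "snd (C - e) < 0" and "\<bar>fst (C - e)\<bar> \<le> (M + 1/2) / 2 * (- snd (C - e))"
    and "18 * \<zeta> * (- snd N) < 4 * fst N + snd N \<Longrightarrow> 4 * fst (C - e) < snd (C - e)"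
    and "18 * \<zeta> * (- snd N) < - 4 * fst N + snd N \<Longrightarrow> - snd (C - e) < 4 * fst (C - e)"
proof -
  define a x u v \<nu> where "a = - snd N" and "x = fst N" and "u = fst e" and "v = snd e" and "\<nu> = - (N \<bullet> e)"
  have Neq: "N = (x, - a)" and eeq: "e = (u, v)" by (simp_all add: a_def x_def u_def v_def)
  have a: "0 < a" "\<bar>x\<bar> \<le> M * a" using N by (simp_all add: a_def x_def)
  have v: "0 < v" "\<bar>u\<bar> \<le> \<zeta> * v" using e by (simp_all add: u_def v_def)
  have M0: "0 \<le> M" using a by (smt (verit) zero_le_mult_iff)
  have z12: "\<zeta> \<le> 1/12" using z M0 by simp
  define S where "S = a * v\<^sup>2"
  have S: "0 < S" using a v by (simp add: S_def)
  have uv: "\<bar>u * v\<bar> \<le> \<zeta> * v\<^sup>2"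
    using mult_right_mono[OF v(2), of v] v(1) by (simp add: abs_mult power2_eq_square mult.assoc)
  have u2: "u\<^sup>2 \<le> \<zeta> * v\<^sup>2"
  proof -
    have "\<bar>u\<bar>\<^sup>2 \<le> (\<zeta> * v)\<^sup>2" using v by (intro power_mono) auto
    also have "\<dots> = \<zeta> * (\<zeta> * v\<^sup>2)" by (simp add: power2_eq_square)
    also have "\<dots> \<le> \<zeta> * (1 * v\<^sup>2)" using z z12 by (intro mult_left_mono mult_right_mono) auto
    finally show ?thesis by simp
  qed
  have v2: "0 < v\<^sup>2" using v by simp
  have zv: "\<zeta> * v\<^sup>2 \<le> 1/12 * v\<^sup>2" using z12 by (intro mult_right_mono) auto
  have "M * a \<le> 1/2 * a" using a N(3) by (intro mult_right_mono) auto
  then have x2: "\<bar>x\<bar> \<le> a / 2" using a by linarith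
  have xu: "\<bar>x * u\<bar> \<le> a * v / 24"
  proof -
    have "\<zeta> * v \<le> 1/12 * v" using z12 v by (intro mult_right_mono) auto
    then have "\<bar>x\<bar> * \<bar>u\<bar> \<le> (a / 2) * (1/12 * v)"
      using x2 v a by (intro mult_mono) linarith+
    then show ?thesis by (simp add: abs_mult)
  qed
  have \<nu>: "\<nu> = a * v - x * u" by (simp add: \<nu>_def Neq eeq)
  have av: "0 < a * v" using a v by simp
  then have \<nu>2: "a * v / 2 \<le> \<nu>" using xu \<nu> by (simp add: abs_le_iff)
  with av have \<nu>0: "0 < \<nu>" by simp
  then show Ne: "N \<bullet> e < 0" by (simp add: \<nu>_def)
  \<comment> \<open>\<open>C = - l *\<^sub>R N\<close> with \<open>l > 0\<close>: the centres lie on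
    opposite sides of the origin, which is external tangency there.\<close>
  define l where "l = e \<bullet> e / (2 * \<nu>)"
  have ee: "e \<bullet> e = u\<^sup>2 + v\<^sup>2" by (simp add: eeq power2_eq_square)
  have l0: "0 < l" using \<nu>0 v2 by (simp add: l_def ee add_nonneg_pos)
  have Cl: "C = - l *\<^sub>R N" unfolding C l_def \<nu>_def by simp
  show "dist e C = dist 0 C"
  proof -
    have "2 * (e \<bullet> C) = e \<bullet> e" unfolding C using Ne by (simp add: inner_commute)
    then show ?thesis unfolding on_circle_iff by simp
  qed
  have nN: "norm N \<le> 3 / 2 * a"
    using norm_Pair_le[of x "- a"] x2 a unfolding Neq by simp
  have nN0: "0 < norm N" using a by (simp add: Neq zero_prod_def)
  have nC: "norm C = l * norm N" using l0 by (simp add: Cl)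
  have "l * (a * v) \<le> l * (2 * \<nu>)" using \<nu>2 l0 by simp
  also have "\<dots> = u\<^sup>2 + v\<^sup>2" using \<nu>0 by (simp add: l_def ee)
  also have "\<dots> \<le> (2 * v) * v" using u2 zv v2 by (simp add: power2_eq_square)
  finally have "l * a \<le> 2 * v" using v by simp
  have "norm C \<le> l * (3 / 2 * a)" unfolding nC using nN l0 by simp
  also have "\<dots> \<le> 4 * v" using \<open>l * a \<le> 2 * v\<close> v by simp
  finally show "norm C \<le> 4 * snd e" by (simp add: v_def)
  have "N - C = (1 + l) *\<^sub>R N" unfolding Cl by (simp add: algebra_simps)
  then have "dist N C = (1 + l) * norm N" using l0 by (simp add: dist_norm del: scaleR_add_left)
  then show "dist N C = norm N + norm C" using nC by (simp add: algebra_simps)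
  show "norm N + snd e / 3 \<le> dist e N"
  proof -
    \<comment> \<open>The distance from \<open>e\<close> to \<open>N\<close> is bounded below by
      projecting \<open>N - e\<close> onto the direction of \<open>N\<close>.\<close>
    have "norm N * (v / 3) \<le> 3 / 2 * a * (v / 3)" using nN v(1) by (intro mult_right_mono) auto
    then have "norm N * (norm N + v / 3) \<le> norm N * norm N + \<nu>"
      unfolding distrib_left using \<nu>2 by linarith
    also have "\<dots> = (N - e) \<bullet> N"
      by (simp add: \<nu>_def inner_diff_left dot_square_norm power2_eq_square inner_commute[of e N])
    also have "\<dots> \<le> norm (N - e) * norm N" by (rule norm_cauchy_schwarz)
    finally have "norm N * (norm N + v / 3) \<le> norm N * dist e N"
      by (simp add: dist_norm norm_minus_commute mult.commute)
    then show ?thesis using nN0 by (simp add: v_def)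
  qed
  define F G where "F = fst (C - e)" and "G = snd (C - e)"
  have l2: "2 * \<nu> * l = u\<^sup>2 + v\<^sup>2" using \<nu>0 by (simp add: l_def ee)
  \<comment> \<open>\<open>C - e\<close> is a positive multiple of \<open>(- X, - Y)\<close>. For
    \<open>u = 0\<close> this has the direction \<open>(- x, - a)\<close>, the mirror image of
    \<open>N\<close>; each term containing \<open>u\<close> is an error of order
    \<open>\<zeta> * S\<close>.\<close>
  define X Y where "X = x * (v\<^sup>2 - u\<^sup>2) + 2 * a * (u * v)" and "Y = a * (v\<^sup>2 - u\<^sup>2) - 2 * x * (u * v)"
  have "2 * \<nu> * F = - (2 * \<nu> * l) * x - 2 * \<nu> * u"
    by (simp add: F_def G_def Cl Neq eeq algebra_simps)
  then have fX: "2 * \<nu> * F = - X"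
    unfolding l2 by (simp add: X_def \<nu> algebra_simps power2_eq_square)
  have "2 * \<nu> * G = (2 * \<nu> * l) * a - 2 * \<nu> * v"
    by (simp add: F_def G_def Cl Neq eeq algebra_simps)
  then have sY: "2 * \<nu> * G = - Y"
    unfolding l2 by (simp add: Y_def \<nu> algebra_simps power2_eq_square)
  have xuv: "\<bar>2 * x * (u * v)\<bar> \<le> \<zeta> * S"
  proof -
    have "\<bar>x\<bar> * \<bar>u * v\<bar> \<le> (a / 2) * (\<zeta> * v\<^sup>2)" using x2 uv a by (intro mult_mono) auto
    then show ?thesis by (simp add: abs_mult S_def algebra_simps)
  qed
  have auv: "\<bar>a * (u * v)\<bar> \<le> \<zeta> * S"
    using mult_left_mono[OF uv, of a] a by (simp add: abs_mult S_def algebra_simps)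
  have au2: "a * u\<^sup>2 \<le> \<zeta> * S"
    using mult_left_mono[OF u2, of a] a by (simp add: S_def algebra_simps)
  have zS: "\<zeta> * S \<le> 1/12 * S" using z12 S by simp
  have YS: "S - 2 * (\<zeta> * S) \<le> Y"
    using au2 xuv by (simp add: Y_def S_def algebra_simps abs_le_iff)
  then have Y0: "0 < Y" using zS S by linarith
  have "0 < 2 * \<nu> * (- G)" using Y0 sY by simp
  then show "snd (C - e) < 0" using \<nu>0 unfolding G_def[symmetric] by (simp add: mult_less_0_iff)
  \<comment> \<open>Halfway to 1/2: the gap \<open>M' - M\<close> is at least
    \<open>3 * \<zeta>\<close>, which absorbs the errors, and \<open>M'\<close> stays below
    1/2.\<close>
  define M' where "M' = (M + 1/2) / 2"
  have "\<bar>X\<bar> \<le> M' * Y"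
  proof -
    have "u\<^sup>2 \<le> v\<^sup>2" using u2 zv v2 by linarith
    then have "\<bar>v\<^sup>2 - u\<^sup>2\<bar> \<le> v\<^sup>2" by simp
    then have "\<bar>x * (v\<^sup>2 - u\<^sup>2)\<bar> \<le> (M * a) * v\<^sup>2"
      unfolding abs_mult using a M0 by (intro mult_mono) auto
    then have "\<bar>X\<bar> \<le> M * S + 2 * (\<zeta> * S)"
      using auv unfolding X_def by (simp add: S_def algebra_simps)
    also have "\<dots> = (M + 2 * \<zeta>) * S" by (simp add: algebra_simps)
    also have "\<dots> \<le> (M' * (1 - 2 * \<zeta>)) * S"
    proof (rule mult_right_mono)
      have "M' * (2 * \<zeta>) \<le> 1/2 * (2 * \<zeta>)" using N(3) z by (intro mult_right_mono) (auto simp: M'_def)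
      moreover have "M + 3 * \<zeta> \<le> M'" using z by (simp add: M'_def)
      ultimately show "M + 2 * \<zeta> \<le> M' * (1 - 2 * \<zeta>)" unfolding right_diff_distrib by linarith
    qed (use S in simp)
    also have "\<dots> = M' * (S - 2 * (\<zeta> * S))" by (simp add: algebra_simps)
    also have "\<dots> \<le> M' * Y" using YS M0 by (intro mult_left_mono) (auto simp: M'_def)
    finally show ?thesis .
  qed
  moreover have "\<bar>X\<bar> = 2 * \<nu> * \<bar>F\<bar>"
    using fX \<nu>0 by (metis abs_minus_cancel abs_mult abs_of_pos zero_less_numeral mult_pos_pos)
  moreover have "M' * Y = 2 * \<nu> * (M' * (- G))"
    using arg_cong[OF sY, of "\<lambda>z. - (M' * z)"] by (simp add: mult_ac)
  ultimately have "2 * \<nu> * \<bar>F\<bar> \<le> 2 * \<nu> * (M' * (- G))" by linarith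
  then have "\<bar>F\<bar> \<le> M' * (- G)" using \<nu>0 by (subst (asm) mult_le_cancel_left_pos) simp_all
  then show "\<bar>fst (C - e)\<bar> \<le> (M + 1/2) / 2 * (- snd (C - e))"
    unfolding F_def G_def M'_def .
  \<comment> \<open>Since \<open>v\<^sup>2 - u\<^sup>2\<close> is at least half of
    \<open>v\<^sup>2\<close>, the main term exceeds \<open>9 * \<zeta> * S\<close>, which pays for
    the errors \<open>8 * b\<close> and \<open>h\<close>; hence the 18.\<close>
  have key: "0 < (v\<^sup>2 - u\<^sup>2) * g + 8 * b + h" if "18 * \<zeta> * a < g" "\<bar>b\<bar> \<le> \<zeta> * S" "\<bar>h\<bar> \<le> \<zeta> * S" for g b h
  proof -
    have "0 < 18 * \<zeta> * a" using z a by simp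
    then have "0 < g" using that(1) by linarith
    have "v\<^sup>2 / 2 * g \<le> (v\<^sup>2 - u\<^sup>2) * g"
      using \<open>0 < g\<close> u2 zv v2 by (intro mult_right_mono) linarith+
    moreover have "v\<^sup>2 / 2 * (18 * \<zeta> * a) < v\<^sup>2 / 2 * g" using that(1) v2 by simp
    ultimately show ?thesis using that(2,3) by (simp add: S_def algebra_simps abs_le_iff)
  qed
  have comp: "A < B" if "2 * \<nu> * A < 2 * \<nu> * B" for A B using that \<nu>0 by simp
  show "4 * fst (C - e) < snd (C - e)" if "18 * \<zeta> * (- snd N) < 4 * fst N + snd N"
  proof (rule comp)
    have "0 < (v\<^sup>2 - u\<^sup>2) * (4 * x - a) + 8 * (a * (u * v)) + 2 * x * (u * v)"
      using that by (intro key auv xuv) (simp add: a_def x_def)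
    then have "Y < 4 * X" by (simp add: X_def Y_def algebra_simps)
    then show "2 * \<nu> * (4 * fst (C - e)) < 2 * \<nu> * snd (C - e)"
      using fX sY unfolding F_def[symmetric] G_def[symmetric] by linarith
  qed
  show "- snd (C - e) < 4 * fst (C - e)" if "18 * \<zeta> * (- snd N) < - 4 * fst N + snd N"
  proof (rule comp)
    have "0 < (v\<^sup>2 - u\<^sup>2) * (- 4 * x - a) + 8 * (- (a * (u * v))) + 2 * x * (u * v)"
      using that auv by (intro key xuv) (simp_all add: a_def x_def)
    then have "Y < - 4 * X" by (simp add: X_def Y_def algebra_simps)
    then show "2 * \<nu> * (- snd (C - e)) < 2 * \<nu> * (4 * fst (C - e))"
      using fX sY unfolding F_def[symmetric] G_def[symmetric] by linarith
  qed
qed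

text \<open>Each disk lies in the half-plane through the origin with inner normal \<open>N0\<close>
  or \<open>N1\<close>. One normal points steeply down to the right, the other down to the left, so
  the two half-planes meet in a downward cone.\<close>

lemma cone_of_two_disks:
  fixes v N0 N1 :: point
  assumes "snd N0 < 0" "- snd N0 < 4 * fst N0" "snd N1 < 0" "4 * fst N1 < snd N1"
    and v: "v \<bullet> v < 2 * (v \<bullet> N0)" "v \<bullet> v < 2 * (v \<bullet> N1)"
  shows "snd v < - \<bar>fst v\<bar> / 4"
proof -
  have "0 \<le> v \<bullet> v" by simp
  with v have "0 < v \<bullet> N0" "0 < v \<bullet> N1" by linarith+
  then have pos: "0 < fst v * fst N0 + snd v * snd N0" "0 < fst v * fst N1 + snd v * snd N1"
    by (simp_all add: inner_prod_def)
  show ?thesis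
  proof (cases "0 \<le> fst v")
    case True
    then have "fst v * (4 * fst N1) \<le> fst v * snd N1" using assms(4) by (intro mult_left_mono) auto
    then have "0 < snd N1 * (fst v + 4 * snd v)" using pos(2) by (simp add: algebra_simps)
    then show ?thesis using True assms(3) by (simp add: zero_less_mult_iff)
  next
    case False
    then have "fst v * (4 * fst N0) \<le> fst v * (- snd N0)" using assms(2) by (intro mult_left_mono_neg) auto
    then have "0 < snd N0 * (4 * snd v - fst v)" using pos(1) by (simp add: algebra_simps)
    then show ?thesis using False assms(1) by (simp add: zero_less_mult_iff)
  qed
qed

text \<open>The last point keeps a positive distance, uniformly in \<open>t\<close>, from all disks but the last one; as seen
  from it, the centre of the last disk lies steeply below, to the right for some \<open>t\<close> and to the left for
  another.\<close>

definition extendable_chain :: "nat \<Rightarrow> (nat \<Rightarrow> point) \<Rightarrow> (nat \<Rightarrow> real \<Rightarrow> point) \<Rightarrow> bool" where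
  "extendable_chain k p c \<longleftrightarrow> disk_chain (Suc k) p c \<and>
     (\<exists>\<rho>>0. \<forall>i<k. \<forall>t\<in>params. dist (p (Suc i)) (c i t) + \<rho> \<le> dist (p (Suc k)) (c i t)) \<and>
     (\<exists>M<1/2. \<forall>t\<in>params. snd (c k t - p (Suc k)) < 0 \<and>
        \<bar>fst (c k t - p (Suc k))\<bar> \<le> M * (- snd (c k t - p (Suc k)))) \<and>
     (\<exists>t\<in>params. - snd (c k t - p (Suc k)) < 4 * fst (c k t - p (Suc k))) \<and>
     (\<exists>t\<in>params. 4 * fst (c k t - p (Suc k)) < snd (c k t - p (Suc k)))"

text \<open>The new point \<open>q\<close> is put almost vertically above the last point
  \<open>P\<close>, and the new disk touches the last disk at \<open>P\<close>. For a short step it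
  stays clear of the older disks and the end-to-end slope stays below 1/4.\<close>

lemma extend_chain:
  assumes ext: "extendable_chain k p c"
  shows "\<exists>p' c'. extendable_chain (Suc k) p' c'"
proof -
  define m where "m = Suc k"
  define P where "P = p m"
  define N where "N t = c k t - P" for t
  have ck: "c k t = P + N t" for t by (simp add: N_def)
  have ch: "disk_chain m p c" using ext by (simp add: extendable_chain_def m_def)
  have inj: "inj_on p {..m}" and gp: "general_position (p ` {..m})"
    and cont: "\<And>i. i < m \<Longrightarrow> continuous_on params (c i)"
    and circ: "\<And>i t. i < m \<Longrightarrow> t \<in> params \<Longrightarrow> dist (p i) (c i t) = dist (p (Suc i)) (c i t)"
    and tang: "\<And>i j t. i < m \<Longrightarrow> j < i \<Longrightarrow> t \<in> params \<Longrightarrow>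
        dist (p (Suc i)) (c i t) + dist (p (Suc j)) (c j t) \<le> dist (c i t) (c j t)"
    and cone: "\<And>i. i < m \<Longrightarrow> \<exists>k\<le>m. \<forall>w. (\<forall>t\<in>params. dist w (c i t) < dist (p (Suc i)) (c i t)) \<longrightarrow>
        snd w - snd (p k) < - \<bar>fst w - fst (p k)\<bar> / 4"
    and p0: "p 0 = (-1, 1)" "- 1 < fst P"
    using ch unfolding disk_chain_def P_def by meson+
  obtain s where s: "0 \<le> s" "s < 1/4" "snd P = 1 + s * (fst P + 1)"
    "\<And>j. j \<le> m \<Longrightarrow> - 1 \<le> fst (p j)" "\<And>j. j \<le> m \<Longrightarrow> snd (p j) \<le> 1 + s * (fst (p j) + 1)"
    using ch unfolding disk_chain_def P_def by meson
  note ext' = ext[unfolded extendable_chain_def m_def[symmetric] P_def[symmetric] N_def[symmetric], THEN conjunct2]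
  obtain \<rho> where \<rho>: "0 < \<rho>" "\<And>i t. i < k \<Longrightarrow> t \<in> params \<Longrightarrow> dist (p (Suc i)) (c i t) + \<rho> \<le> dist P (c i t)"
    using ext' by meson
  obtain M where M: "M < 1/2" "\<And>t. t \<in> params \<Longrightarrow> snd (N t) < 0"
    "\<And>t. t \<in> params \<Longrightarrow> \<bar>fst (N t)\<bar> \<le> M * (- snd (N t))"
    using ext' by meson
  obtain t0 where t0: "t0 \<in> params" "- snd (N t0) < 4 * fst (N t0)" using ext' by meson
  obtain t1 where t1: "t1 \<in> params" "4 * fst (N t1) < snd (N t1)" using ext' by meson
  \<comment> \<open>Three upper bounds on \<open>\<zeta>\<close>, each encoded as a coefficient and
    a positive limit.\<close>
  define Q :: "(real \<times> real) set" where "Q = {(6, 1/2 - M), (18 * (- snd (N t0)), 4 * fst (N t0) + snd (N t0)),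
      (18 * (- snd (N t1)), - 4 * fst (N t1) + snd (N t1))}"
  have "finite Q" by (simp add: Q_def)
  moreover have "0 < snd x" if "x \<in> Q" for x
    using that M(1) t0(2) t1(2) by (auto simp: Q_def)
  ultimately obtain \<zeta> where "0 < \<zeta>" "\<forall>x\<in>Q. \<zeta> * fst x < snd x"
    using finite_small_multiple[of Q snd fst] by blast
  then have \<zeta>: "0 < \<zeta>" "6 * \<zeta> \<le> 1/2 - M" "18 * \<zeta> * (- snd (N t0)) < 4 * fst (N t0) + snd (N t0)"
     "18 * \<zeta> * (- snd (N t1)) < - 4 * fst (N t1) + snd (N t1)"
    by (simp_all add: Q_def algebra_simps)
  have "0 \<le> M" using M(2,3)[OF t0(1)] by (smt (verit) zero_le_mult_iff)
  then have \<zeta>12: "\<zeta> \<le> 1/12" using \<zeta>(2) by simp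
  \<comment> \<open>The new radius is below \<open>4 * \<epsilon>\<close>, so twice it is at most
    \<open>\<rho>\<close>, which separates the new disk from those before the last. The second bound
    keeps the new slope below 1/4 and \<open>q\<close> to the right of \<open>p 0\<close>.\<close>
  define \<epsilon> where "\<epsilon> = min (\<rho> / 8) ((1 - 4 * s) * (fst P + 1) / 5)"
  have \<epsilon>: "0 < \<epsilon>" "8 * \<epsilon> \<le> \<rho>" "5 * \<epsilon> \<le> (1 - 4 * s) * (fst P + 1)"
    using \<rho>(1) s(2) p0(2) by (simp_all add: \<epsilon>_def min_def)
  define U :: "point set" where "U = {q. 0 < snd q - snd P \<and> snd q - snd P < \<epsilon> \<and> \<bar>fst q - fst P\<bar> < \<zeta> * (snd q - snd P)}"
  have "open U"
    unfolding U_def by (intro open_Collect_conj open_Collect_less continuous_intros)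
  moreover have "P + (0, \<epsilon> / 2) \<in> U" using \<epsilon>(1) \<zeta>(1) by (simp add: U_def)
  ultimately obtain q where q: "q \<in> U" "q \<notin> p ` {..m}" "general_position (insert q (p ` {..m}))"
    using extend_general_position[OF _ gp, of U] by blast
  define e where "e = q - P"
  have qe: "q = P + e" by (simp add: e_def)
  have e: "0 < snd e" "snd e < \<epsilon>" "\<bar>fst e\<bar> \<le> \<zeta> * snd e" using q(1) by (simp_all add: U_def e_def)
  have ex: "\<bar>fst e\<bar> \<le> snd e / 12"
  proof -
    have "\<zeta> * snd e \<le> 1/12 * snd e" using \<zeta>12 e(1) by (intro mult_right_mono) auto
    then show ?thesis using e(3) by linarith
  qed
  define C where "C t = (e \<bullet> e / (2 * (N t \<bullet> e))) *\<^sub>R N t" for t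
  note step = tangent_disk_step[OF M(2) M(3) M(1) e(1,3) \<zeta>(1,2) C_def]
  define p' where "p' = p(Suc m := q)"
  define c' where "c' = c(m := \<lambda>t. P + C t)"
  have old: "\<And>i. i \<le> m \<Longrightarrow> p' i = p i" "\<And>i. i < m \<Longrightarrow> c' i = c i"
    and new: "p' (Suc m) = q" "c' m = (\<lambda>t. P + C t)"
    by (simp_all add: p'_def c'_def)
  have ckk: "c' k = c k" using old(2)[of k] by (simp add: m_def)
  have pm: "p m = P" by (simp add: P_def)
  have dP: "dist P (P + x) = norm x" for x by (simp add: dist_norm)
  have rad: "dist q (P + C t) = norm (C t)" if "t \<in> params" for t
    using step(2)[OF that that] by (simp add: qe)
  have N': "c' m t - p' (Suc m) = C t - e" for t by (simp add: new qe)
  \<comment> \<open>The mirroring swaps roles: the centre at \<open>t0\<close> now lies to the left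
    and that at \<open>t1\<close> to the right.\<close>
  have ext0: "4 * fst (C t0 - e) < snd (C t0 - e)" by (rule step(8)[OF t0(1) t0(1) \<zeta>(3)])
  have ext1: "- snd (C t1 - e) < 4 * fst (C t1 - e)" by (rule step(9)[OF t1(1) t1(1) \<zeta>(4)])
  have "disk_chain (Suc m) p' c'"
    unfolding disk_chain_def
  proof (intro conjI allI impI ballI)
    have im: "p' ` {..m} = p ` {..m}" using old(1) by (intro image_cong) auto
    have "inj_on p' {..m}" using inj old(1) by (simp add: inj_on_def)
    then show "inj_on p' {..Suc m}"
      using q(2) by (simp add: atMost_Suc im new)
    show "general_position (p' ` {..Suc m})"
      using q(3) by (simp add: atMost_Suc im new)
    show "p' 0 = (- 1, 1)" using p0(1) old(1)[of 0] by simp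
  next
    fix i assume "i < Suc m"
    then consider "i < m" | "i = m" by linarith
    then show "continuous_on params (c' i)"
    proof cases
      case 1 then show ?thesis using cont old(2) by simp
    next
      case 2
      have "continuous_on params N"
        unfolding N_def using cont[of k] by (intro continuous_intros) (simp add: m_def)
      moreover have "N t \<bullet> e \<noteq> 0" if "t \<in> params" for t using step(1)[OF that that] by simp
      ultimately show ?thesis
        unfolding 2 new C_def by (intro continuous_intros) auto
    qed
  next
    fix i t assume "i < Suc m" and t: "t \<in> params"
    then consider "i < m" | "i = m" by linarith
    then show "dist (p' i) (c' i t) = dist (p' (Suc i)) (c' i t)"
    proof cases
      case 1 then show ?thesis using circ t by (simp add: old)
    next
      case 2 then show ?thesis using rad[OF t] by (simp add: old new pm dP)
    qed
  next
    fix i j t assume ij: "i < Suc m" "j < i" and t: "t \<in> params"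
    then consider "i < m" | "i = m" "j = k" | "i = m" "j < k" unfolding m_def by linarith
    then show "dist (p' (Suc i)) (c' i t) + dist (p' (Suc j)) (c' j t) \<le> dist (c' i t) (c' j t)"
    proof cases
      case 1 then show ?thesis using ij tang t by (simp add: old)
    next
      case 2
      then have "dist (p' (Suc j)) (c' j t) = norm (N t)" "dist (c' i t) (c' j t) = dist (N t) (C t)"
        using old(1)[of m] ckk by (simp_all add: m_def[symmetric] pm new ck dP dist_commute)
      then show ?thesis using 2 rad[OF t] step(4)[OF t t] by (simp add: new)
    next
      case 3
      then have j: "p' (Suc j) = p (Suc j)" "c' j = c j" using old by (simp_all add: m_def)
      have "dist P (c j t) \<le> dist P (P + C t) + dist (P + C t) (c j t)" by (rule dist_triangle)
      then show ?thesis
        using 3 \<rho>(2)[OF 3(2) t] step(3)[OF t t] e(2) \<epsilon>(2) rad[OF t] by (simp add: new j dP)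
    qed
  next
    fix i assume "i < Suc m"
    then consider "i < m" | "i = m" by linarith
    then show "\<exists>k\<le>Suc m. \<forall>w. (\<forall>t\<in>params. dist w (c' i t) < dist (p' (Suc i)) (c' i t)) \<longrightarrow>
        snd w - snd (p' k) < - \<bar>fst w - fst (p' k)\<bar> / 4"
    proof cases
      case 1
      then obtain l where "l \<le> m" "\<forall>w. (\<forall>t\<in>params. dist w (c i t) < dist (p (Suc i)) (c i t)) \<longrightarrow>
        snd w - snd (p l) < - \<bar>fst w - fst (p l)\<bar> / 4" using cone by blast
      then show ?thesis using 1 by (intro exI[of _ l]) (simp add: old del: split_paired_All)
    next
      case 2
      have "snd w - snd q < - \<bar>fst w - fst q\<bar> / 4" if w: "\<forall>t\<in>params. dist w (c' i t) < dist (p' (Suc i)) (c' i t)" for w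
      proof -
        have "(w - q) \<bullet> (w - q) < 2 * ((w - q) \<bullet> (C t - e))" if "t \<in> params" for t
          using w[rule_format, OF that] unfolding mem_disk_iff by (simp add: 2 new qe)
        from cone_of_two_disks[OF step(6)[OF t1(1) t1(1)] ext1 step(6)[OF t0(1) t0(1)] ext0
            this[OF t1(1)] this[OF t0(1)]]
        show ?thesis by simp
      qed
      then show ?thesis unfolding 2 by (intro exI[of _ "Suc m"]) (simp add: new del: split_paired_All)
    qed
  next
    have X: "0 < fst q + 1"
    proof -
      have "(1 - 4 * s) * (fst P + 1) \<le> 1 * (fst P + 1)" using s p0(2) by (intro mult_right_mono) auto
      then show ?thesis using ex e \<epsilon>(3) by (simp add: qe)
    qed
    then show "- 1 < fst (p' (Suc m))" by (simp add: new)
    \<comment> \<open>The slope of the line from \<open>p 0\<close> to \<open>q\<close>. As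
      \<open>q\<close> lies above the old line, this slope is no smaller, so the older points, none
      to the left of \<open>p 0\<close>, stay below the new line.\<close>
    define s' where "s' = (snd q - 1) / (fst q + 1)"
    have s'q: "snd q - 1 = s' * (fst q + 1)" using X by (simp add: s'_def)
    have sq: "snd q - 1 = s * (fst q + 1) + (snd e - s * fst e)" using s(3) by (simp add: qe algebra_simps)
    have "s * fst e \<le> s * \<bar>fst e\<bar>" using s(1) by (intro mult_left_mono) auto
    also have "\<dots> \<le> 1 * \<bar>fst e\<bar>" using s(2) by (intro mult_right_mono) auto
    finally have "s * (fst q + 1) \<le> s' * (fst q + 1)"
      using ex e(1) sq s'q by linarith
    then have ss': "s \<le> s'" using X by simp
    have "snd q - 1 < 1/4 * (fst q + 1)"
    proof -
      define Z where "Z = s * (fst P + 1)"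
      have "5 * \<epsilon> \<le> (fst P + 1) - 4 * Z" using \<epsilon>(3) by (simp add: Z_def algebra_simps)
      moreover have "snd q - 1 = Z + snd e" "fst q + 1 = fst P + 1 + fst e"
        using s(3) by (simp_all add: qe Z_def)
      moreover have "- fst e \<le> snd e / 12" using ex by (simp add: abs_le_iff)
      ultimately show ?thesis using e(1,2) by (simp add: field_simps)
    qed
    then have "s' < 1/4" using X unfolding s'_def by (simp add: divide_less_eq)
    moreover have "- 1 \<le> fst (p' j) \<and> snd (p' j) \<le> 1 + s' * (fst (p' j) + 1)" if "j \<le> Suc m" for j
    proof (cases "j = Suc m")
      case True then show ?thesis using X s'q by (simp add: new)
    next
      case False
      with that have j: "j \<le> m" by simp
      have "s * (fst (p j) + 1) \<le> s' * (fst (p j) + 1)" using s(4)[OF j] ss' by (intro mult_right_mono) auto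
      then show ?thesis using s(4,5)[OF j] by (simp add: old(1)[OF j])
    qed
    ultimately show "\<exists>s. 0 \<le> s \<and> s < 1/4 \<and> snd (p' (Suc m)) = 1 + s * (fst (p' (Suc m)) + 1) \<and>
        (\<forall>j\<le>Suc m. - 1 \<le> fst (p' j) \<and> snd (p' j) \<le> 1 + s * (fst (p' j) + 1))"
      using s(1) ss' s'q by (intro exI[of _ s']) (simp add: new)
  qed
  moreover have "\<exists>\<rho>'>0. \<forall>i<m. \<forall>t\<in>params. dist (p' (Suc i)) (c' i t) + \<rho>' \<le> dist (p' (Suc m)) (c' i t)"
  \<comment> \<open>Moving from \<open>P\<close> to \<open>q\<close> costs the older disks at most
    \<open>norm e\<close>, less than \<open>\<rho> / 2\<close>; disk \<open>k\<close>, with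
    \<open>P\<close> on its boundary, gains \<open>snd e / 3\<close>.\<close>
  proof (intro exI[of _ "min (\<rho> / 2) (snd e / 3)"] conjI allI impI ballI)
    show "0 < min (\<rho> / 2) (snd e / 3)" using \<rho>(1) e(1) by simp
    fix i t assume i: "i < m" and t: "t \<in> params"
    have eq: "p' (Suc i) = p (Suc i)" "c' i = c i" using i by (simp_all add: old)
    show "dist (p' (Suc i)) (c' i t) + min (\<rho> / 2) (snd e / 3) \<le> dist (p' (Suc m)) (c' i t)"
    proof (cases "i = k")
      case True
      have "dist (p (Suc k)) (c k t) = norm (N t)" "dist q (c k t) = dist e (N t)"
        using pm by (simp_all add: m_def ck qe dP)
      then show ?thesis using step(5)[OF t t] eq by (simp add: True new)
    next
      case False
      then have "i < k" using i by (simp add: m_def)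
      have "norm e \<le> \<bar>fst e\<bar> + \<bar>snd e\<bar>" using norm_Pair_le[of "fst e" "snd e"] by simp
      moreover have "dist P (c i t) \<le> dist P q + dist q (c i t)" by (rule dist_triangle)
      moreover have "dist P q = norm e" by (simp add: qe dP)
      ultimately show ?thesis
        using \<rho>(2)[OF \<open>i < k\<close> t] \<epsilon>(2) e ex by (simp add: eq new)
    qed
  qed
  moreover have "\<exists>M<1/2. \<forall>t\<in>params. snd (C t - e) < 0 \<and> \<bar>fst (C t - e)\<bar> \<le> M * (- snd (C t - e))"
    using M(1) step(6,7) by (intro exI[of _ "(M + 1/2) / 2"]) auto
  ultimately have "extendable_chain m p' c'"
    unfolding extendable_chain_def N' using ext0 ext1 t0(1) t1(1) by blast
  then show ?thesis unfolding m_def by blast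
qed

section \<open>The initial chain on three points\<close>

lemma general_position_triple:
  assumes "\<not> collinear {a, b, c}"
  shows "general_position {a, b, c}"
proof -
  have 3: "card {a, b, c} \<le> 3"
    using card_insert_le_m1[of 3 "{b, c}" a] card_insert_le_m1[of 2 "{c}" b] by simp
  have triple: "{x, y, z} = {a, b, c}" if "{x, y, z} \<subseteq> {a, b, c}" "x \<noteq> y" "x \<noteq> z" "y \<noteq> z" for x y z
    using that 3 by (intro card_seteq) auto
  have quadruple: False
    if "{x, y, z, w} \<subseteq> {a, b, c}" "x \<noteq> y" "x \<noteq> z" "x \<noteq> w" "y \<noteq> z" "y \<noteq> w" "z \<noteq> w" for x y z w
    using card_mono[OF _ that(1)] that(2-) 3 by simp
  show ?thesis
    unfolding general_position_def
  proof (intro conjI ballI impI; elim conjE)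
    fix x y z assume "x \<in> {a, b, c}" "y \<in> {a, b, c}" "z \<in> {a, b, c}" "x \<noteq> y" "x \<noteq> z" "y \<noteq> z"
    then have "{x, y, z} = {a, b, c}" by (intro triple) (simp_all only: insert_subset empty_subsetI simp_thms)
    with assms show "\<not> collinear {x, y, z}" by (simp only: simp_thms)
  next
    fix x y z w assume "x \<in> {a, b, c}" "y \<in> {a, b, c}" "z \<in> {a, b, c}" "w \<in> {a, b, c}"
      "x \<noteq> y" "x \<noteq> z" "x \<noteq> w" "y \<noteq> z" "y \<noteq> w" "z \<noteq> w"
    then have False by (intro quadruple[of x y z w]) (simp_all only: insert_subset empty_subsetI simp_thms)
    then show "\<not> concyclic {x, y, z, w}" ..
  qed
qed

text \<open>The two disks touch at the origin, with centres in the opposite directions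
  \<open>(-1, t)\<close> and \<open>(1, - t)\<close>; the factors \<open>1 / (1 + t)\<close> and
  \<open>1 / (1 - t)\<close> make the circles pass through \<open>(-1, 1)\<close> and
  \<open>(1, 1)\<close>. Varying \<open>t\<close> tilts the common tangent.\<close>

lemma base_chain:
  "extendable_chain 1 (\<lambda>i. if i = 0 then (-1, 1) else if i = 1 then 0 else (1, 1))
     (\<lambda>i t. if i = 0 then (1 / (1 + t)) *\<^sub>R (-1, t) else (1 / (1 - t)) *\<^sub>R (1, - t))"
  (is "extendable_chain 1 ?p ?c")
proof -
  define p where "p = ?p"
  define c where "c = ?c"
  have p: "p 0 = (-1, 1)" "p (Suc 0) = 0" "p (Suc (Suc 0)) = (1, 1)" by (simp_all add: p_def)
  have cf: "c 0 = (\<lambda>t. (1 / (1 + t)) *\<^sub>R (-1, t))" "c (Suc 0) = (\<lambda>t. (1 / (1 - t)) *\<^sub>R (1, - t))"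
    by (simp_all add: c_def)
  then have c: "c 0 t = (1 / (1 + t)) *\<^sub>R (-1, t)" "c (Suc 0) t = (1 / (1 - t)) *\<^sub>R (1, - t)" for t
    by simp_all
  have le2: "k \<le> Suc (Suc 0) \<longleftrightarrow> k = 0 \<or> k = Suc 0 \<or> k = Suc (Suc 0)" for k by auto
  have lt2: "k < Suc (Suc 0) \<longleftrightarrow> k = 0 \<or> k = Suc 0" for k by auto
  have at2: "{..Suc (Suc 0)} = {0, Suc 0, Suc (Suc 0)}" by auto
  have N0: "c 0 t - p 0 = (1 / (1 + t)) *\<^sub>R (t, -1)" if "t \<in> params" for t
    using that by (simp add: p c divide_simps)
  have N1: "c (Suc 0) t - p (Suc (Suc 0)) = (1 / (1 - t)) *\<^sub>R (t, -1)" if "t \<in> params" for t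
    using that by (simp add: p c divide_simps)
  have circ: "dist (p i) (c i t) = dist (p (Suc i)) (c i t)" if "i < Suc (Suc 0)" "t \<in> params" for i t
    using that unfolding lt2 on_circle_iff by (elim disjE) (simp_all add: p c divide_simps)
  have end0: "1/3 \<in> params" and end1: "-1/3 \<in> params" by auto
  have cone: "snd w - snd a < - \<bar>fst w - fst a\<bar> / 4"
    if w: "\<forall>t\<in>params. dist w (f t) < dist a (f t)"
      and f: "f (1/3) - a = x *\<^sub>R (1/3, -1)" "f (-1/3) - a = y *\<^sub>R (-1/3, -1)" "0 < x" "0 < y"
    for w a :: point and f :: "real \<Rightarrow> point" and x y :: real
  proof -
    have "snd (w - a) < - \<bar>fst (w - a)\<bar> / 4"
    proof (rule cone_of_two_disks)
      show "(w - a) \<bullet> (w - a) < 2 * ((w - a) \<bullet> (f (1/3) - a))"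
        "(w - a) \<bullet> (w - a) < 2 * ((w - a) \<bullet> (f (-1/3) - a))"
        using w end0 end1 unfolding mem_disk_iff by blast+
    qed (use f in simp_all)
    then show ?thesis by simp
  qed
  have ch: "disk_chain (Suc (Suc 0)) p c"
    unfolding disk_chain_def
  proof (intro conjI allI impI ballI)
    show "inj_on p {..Suc (Suc 0)}" unfolding at2 by (simp add: p zero_prod_def)
    have "\<not> collinear {(-1, 1), 0, (1, 1) :: point}" by (simp add: collinear_iff_cross cross_def)
    then show "general_position (p ` {..Suc (Suc 0)})"
      unfolding at2 by (simp add: p general_position_triple)
  next
    fix i assume "i < Suc (Suc 0)"
    then show "continuous_on params (c i)"
      unfolding lt2
    proof (elim disjE)
      assume i: "i = 0" show ?thesis
        unfolding i cf by (intro continuous_intros) auto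
    next
      assume i: "i = Suc 0" show ?thesis
        unfolding i cf by (intro continuous_intros) auto
    qed
  next
    fix i t assume "i < Suc (Suc 0)" "t \<in> params"
    then show "dist (p i) (c i t) = dist (p (Suc i)) (c i t)" by (rule circ)
  next
    fix i j t assume ij: "i < Suc (Suc 0)" "j < i" and t: "t \<in> params"
    then have [simp]: "i = Suc 0" "j = 0" by auto
    define u v :: real where "u = 1 / (1 + t)" and "v = 1 / (1 - t)"
    have uv: "0 < u" "0 < v" using t by (auto simp: u_def v_def)
    have "dist (p (Suc i)) (c i t) = v * norm ((1, - t) :: point)"
      using circ[of "Suc 0" t, symmetric] t uv
      by (simp add: p(2) c(2) v_def[symmetric] dist_norm del: scaleR_Pair)
    moreover have "dist (p (Suc j)) (c j t) = u * norm ((1, - t) :: point)"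
      using uv by (simp add: p(2) c(1) u_def[symmetric] dist_norm norm_Pair del: scaleR_Pair)
    moreover have "c i t - c j t = (v + u) *\<^sub>R (1, - t)"
      unfolding c \<open>i = Suc 0\<close> \<open>j = 0\<close> u_def[symmetric] v_def[symmetric] by (simp add: algebra_simps)
    then have "dist (c i t) (c j t) = (v + u) * norm ((1, - t) :: point)"
      using uv unfolding dist_norm by (simp del: scaleR_Pair)
    ultimately show "dist (p (Suc i)) (c i t) + dist (p (Suc j)) (c j t) \<le> dist (c i t) (c j t)"
      by (simp add: algebra_simps)
  next
    fix i assume "i < Suc (Suc 0)"
    then show "\<exists>k\<le>Suc (Suc 0). \<forall>w. (\<forall>t\<in>params. dist w (c i t) < dist (p (Suc i)) (c i t)) \<longrightarrow>
        snd w - snd (p k) < - \<bar>fst w - fst (p k)\<bar> / 4"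
      unfolding lt2
    proof (elim disjE)
      assume [simp]: "i = 0"
      show ?thesis
      proof (intro exI[of _ 0] conjI allI impI)
        fix w assume "\<forall>t\<in>params. dist w (c i t) < dist (p (Suc i)) (c i t)"
        then have "\<forall>t\<in>params. dist w (c 0 t) < dist (p 0) (c 0 t)" using circ[of 0] by simp
        then show "snd w - snd (p 0) < - \<bar>fst w - fst (p 0)\<bar> / 4"
          \<comment> \<open>The factor \<open>1 / (1 + t)\<close> at \<open>t = 1/3\<close> and
            \<open>t = -1/3\<close>.\<close>
          by (rule cone[where x = "3/4" and y = "3/2"]) (use N0[OF end0] N0[OF end1] in auto)
      qed simp
    next
      assume [simp]: "i = Suc 0"
      show ?thesis
      proof (intro exI[of _ "Suc (Suc 0)"] conjI allI impI)
        fix w assume "\<forall>t\<in>params. dist w (c i t) < dist (p (Suc i)) (c i t)"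
        then have "\<forall>t\<in>params. dist w (c (Suc 0) t) < dist (p (Suc (Suc 0))) (c (Suc 0) t)" by simp
        then show "snd w - snd (p (Suc (Suc 0))) < - \<bar>fst w - fst (p (Suc (Suc 0)))\<bar> / 4"
          by (rule cone[where x = "3/2" and y = "3/4"]) (use N1[OF end0] N1[OF end1] in auto)
      qed simp
    qed
  next
    show "\<exists>s. 0 \<le> s \<and> s < 1 / 4 \<and> snd (p (Suc (Suc 0))) = 1 + s * (fst (p (Suc (Suc 0))) + 1) \<and>
      (\<forall>k\<le>Suc (Suc 0). - 1 \<le> fst (p k) \<and> snd (p k) \<le> 1 + s * (fst (p k) + 1))"
      by (intro exI[of _ 0]) (auto simp: le2 p)
  qed (simp_all add: p)
  have sep: "dist (p (Suc i)) (c i t) + 1/3 \<le> dist (p (Suc 1)) (c i t)" if "i < 1" "t \<in> params" for i t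
  proof -
    define u where "u = 1 / (1 + t)"
    have u: "0 < u" "u \<le> 3/2" using that(2) by (auto simp: u_def divide_simps)
    have c0: "c i t = (- u, u * t)" "p (Suc i) = 0" using that(1) by (simp_all add: c p u_def)
    have "norm (c i t) \<le> u + u * \<bar>t\<bar>" using norm_Pair_le[of "- u" "u * t"] u by (simp add: c0 abs_mult)
    also have "\<dots> = u * (1 + \<bar>t\<bar>)" by (simp add: algebra_simps)
    also have "\<dots> \<le> (3/2) * (4/3)" using u that(2) by (intro mult_mono) auto
    finally have n: "norm (c i t) \<le> 2" by simp
    \<comment> \<open>With norm at most 2, the square grows by at most 4/3 + 1/9, less than the 2
      contributed by the squared length of \<open>(1, 1)\<close>.\<close>
    have "(norm (c i t) + 1/3)\<^sup>2 \<le> (norm (c i t))\<^sup>2 + 2"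
      using n by (simp add: power2_eq_square algebra_simps)
    also have "\<dots> \<le> (norm (c i t))\<^sup>2 + 2 + 2 * (u * (1 - t))" using u that(2) by auto
    also have "\<dots> = (dist (p (Suc 1)) (c i t))\<^sup>2"
    proof -
      have "(norm (c i t))\<^sup>2 = u\<^sup>2 + (u * t)\<^sup>2" by (simp add: c0 norm_Pair)
      then show ?thesis
        unfolding dist_sq_point by (simp add: p c0 power2_eq_square algebra_simps)
    qed
    finally have "norm (c i t) + 1/3 \<le> dist (p (Suc 1)) (c i t)" by (rule power2_le_imp_le) simp
    then show ?thesis unfolding c0(2) by simp
  qed
  show ?thesis
    unfolding extendable_chain_def p_def[symmetric] c_def[symmetric]
  proof (intro conjI)
    show "disk_chain (Suc 1) p c" using ch by simp
    show "\<exists>\<rho>>0. \<forall>i<1. \<forall>t\<in>params. dist (p (Suc i)) (c i t) + \<rho> \<le> dist (p (Suc 1)) (c i t)"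
      using sep by (intro exI[of _ "1/3"]) auto
    show "\<exists>M<1/2. \<forall>t\<in>params. snd (c 1 t - p (Suc 1)) < 0 \<and>
        \<bar>fst (c 1 t - p (Suc 1))\<bar> \<le> M * (- snd (c 1 t - p (Suc 1)))"
    proof (intro exI[of _ "1/3"] conjI ballI)
      fix t :: real assume t: "t \<in> params"
      show "snd (c 1 t - p (Suc 1)) < 0" using N1[OF t] t by simp
      have "\<bar>t\<bar> / (1 - t) \<le> (1/3) / (1 - t)" using t by (intro divide_right_mono) auto
      then show "\<bar>fst (c 1 t - p (Suc 1))\<bar> \<le> 1/3 * (- snd (c 1 t - p (Suc 1)))"
        using N1[OF t] t by simp
    qed simp
    show "\<exists>t\<in>params. - snd (c 1 t - p (Suc 1)) < 4 * fst (c 1 t - p (Suc 1))"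
      using end0 N1[OF end0] by (intro bexI[of _ "1/3"]) simp_all
    show "\<exists>t\<in>params. 4 * fst (c 1 t - p (Suc 1)) < snd (c 1 t - p (Suc 1))"
      using end1 N1[OF end1] by (intro bexI[of _ "-1/3"]) simp_all
  qed
qed

section \<open>Assembling both bounds\<close>

lemma disk_chain_exists: "\<exists>p c. disk_chain (k + 2) p c"
proof -
  have "\<exists>p c. extendable_chain (Suc k) p c"
  proof (induction k)
    case 0
    show ?case using base_chain by (metis One_nat_def)
  next
    case (Suc k)
    then show ?case using extend_chain by blast
  qed
  then show ?thesis by (auto simp: extendable_chain_def)
qed

theorem mainTheorem14:
  fixes n :: nat
  assumes "n \<ge> 2"
  shows "enat n \<le> stD_n n \<and> stD_n n \<le> enat (2 * n - 2)"
proof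
  have "\<exists>P. finite P \<and> card P = n \<and> general_position P \<and>
    (\<forall>W. finite W \<longrightarrow> general_position (P \<union> W) \<longrightarrow> stabs_disks P W \<longrightarrow> n \<le> card W)"
  proof (cases "n = 2")
    case True
    \<comment> \<open>The chains start at three points, so two points are treated directly.\<close>
    have ne: "(0, 0) \<noteq> ((1, 0) :: point)" by simp
    have "general_position {(0, 0), (1, 0)}" unfolding general_position_def by auto
    then show ?thesis
      using pair_stabbing_number[OF ne] True by (intro exI[of _ "{(0, 0), (1, 0)}"]) simp
  next
    case False
    then obtain k where k: "n = Suc (k + 2)" using assms by (metis add.commute le_Suc_ex le_neq_implies_less Suc_leI add_Suc)
    \<comment> \<open>A chain of \<open>k + 2\<close> disks has \<open>k + 3 = n\<close> points and
      needs more than \<open>k + 2\<close> witnesses.\<close>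
    obtain p c where ch: "disk_chain (k + 2) p c" using disk_chain_exists by blast
    then have "inj_on p {..k + 2}" "general_position (p ` {..k + 2})" unfolding disk_chain_def by blast+
    then show ?thesis
      using disk_chain_stabbing_number[OF ch] k
      by (intro exI[of _ "p ` {..k + 2}"]) (auto simp: card_image Suc_le_eq)
  qed
  then obtain P where P: "finite P" "card P = n" "general_position P"
    "\<And>W. finite W \<Longrightarrow> general_position (P \<union> W) \<Longrightarrow> stabs_disks P W \<Longrightarrow> n \<le> card W" by blast
  have "enat n \<le> stD P" unfolding stD_def by (intro INF_greatest) (use P(4) in auto)
  also have "\<dots> \<le> stD_n n" unfolding stD_n_def using P by (intro SUP_upper) simp
  finally show "enat n \<le> stD_n n" .
  show "stD_n n \<le> enat (2 * n - 2)"
    unfolding stD_n_def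
  proof (rule SUP_least)
    fix P :: "point set" assume "P \<in> {P. finite P \<and> card P = n \<and> general_position P}"
    then show "stD P \<le> enat (2 * n - 2)" using stD_upper[of P] assms by (cases "P = {}") auto
  qed
qed

end
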